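(* Let $\mathcal E$ be a finite or countably infinite set of edges, each edge $e$ having length $|e|\in(0,\infty)$ and endpoints $e_o$ (initial) and $e_i$ (terminal), and assume $\sup_{e\in\mathcal E}|e|<\infty$. Let $\mathcal H=\bigoplus_{e\in\mathcal E}\mathbb C^2$ and define $\Gamma_0,\Gamma_1:\operatorname{dom}(\mathbf H_{\max})\to\mathcal H$ componentwise by \[ \Gamma_{0,e}f=\begin{pmatrix}\sqrt{|e|}\,f_e(e_o)\\ \sqrt{|e|}\,f_e(e_i)\end{pmatrix},\qquad \Gamma_{1,e}f=|e|^{-3/2}\begin{pmatrix}|e|f_e'(e_o)+f_e(e_o)-f_e(e_i)\\ |e|f_e'(e_i)-f_e(e_o)+f_e(e_i)\end{pmatrix}. \] Then $\{\mathcal H,\Gamma_0,\Gamma_1\}$ is a boundary triplet for $\mathbf H_{\max}=\mathbf H_{\min}^*$, and its Weyl function is $M(z)=\bigoplus_{e\in\mathcal E}M_e(z)$, $z\in\mathbb C\setminus\mathbb R$, where \[ M_e(z)=\frac{1}{|e|}\left(\sqrt z\begin{pmatrix}-\cot(|e|\sqrt z)&\csc(|e|\sqrt z)\\ \csc(|e|\sqrt z)&-\cot(|e|\sqrt z)\end{pmatrix}-\frac1{|e|}\begin{pmatrix}-1&1\\1&-1\end{pmatrix}\right) \] and $\sqrt z$ is the principal branch.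
   Context: Each edge $e$ is identified with the interval $(0,|e|)$, with $e_o$ corresponding to $0$ and $e_i$ to $|e|$. $L^2(\mathcal G)=\bigoplus_{e}L^2(e)$. $\mathbf H_{\min}=\bigoplus_e \mathrm H_{e,\min}$ with $\mathrm H_{e,\min}=-d^2/dx^2$ on $W^{2,2}_0(e)$; $\mathbf H_{\max}=\bigoplus_e\mathrm H_{e,\max}$ with $\mathrm H_{e,\max}=-d^2/dx^2$ on $W^{2,2}(e)$ (the direct-sum domain consists of $f=(f_e)$ with $f_e\in W^{2,2}(e)$ and $\sum_e(\|f_e\|^2+\|f_e''\|^2)<\infty$). For $f_e\in W^{2,2}(e)$, $f_e(v)$ denotes the boundary value at the endpoint $v$, and $f_e'(v)$ the derivative at $v$ taken in the direction pointing into the edge: $f_e'(e_o)=f_e'(0)$, $f_e'(e_i)=-f_e'(|e|)$. Boundary triplet: for a closed densely defined symmetric operator $A$ in a Hilbert space $\mathfrak H$, a triple $\{\mathcal H,\Gamma_0,\Gamma_1\}$ with $\mathcal H$ a Hilbert space and $\Gamma_0,\Gamma_1:\operatorname{dom}(A^* )\to\mathcal H$ linear is a boundary triplet for $A^*$ if $(A^*f,g)-(f,A^*g)=(\Gamma_1f,\Gamma_0g)_{\mathcal H}-(\Gamma_0f,\Gamma_1g)_{\mathcal H}$ for all $f,g\in\operatorname{dom}(A^* )$ and the map $f\mapsto\{\Gamma_0f,\Gamma_1f\}$ is onto $\mathcal H\times\mathcal H$. With $A_0=A^*\restriction\ker\Gamma_0$ (self-adjoint) and $\mathcal N_z=\ker(A^*-z)$,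 the Weyl function is $M(z)=\Gamma_1(\Gamma_0\restriction\mathcal N_z)^{-1}$, $z\in\rho(A_0)$. *)

theory Defs
  imports "HOL-Analysis.Analysis"
begin

text \<open>Quantum graph with edge set E (a countable set of edge labels), edge lengths len.
  A function on the graph is f :: 'e => real => complex; f e is the function on edge e,
  identified with the interval [0, len e] (initial vertex at 0, terminal vertex at len e).\<close>

definition sq_int :: "real \<Rightarrow> (real \<Rightarrow> complex) \<Rightarrow> bool" where
  "sq_int l u \<longleftrightarrow> set_borel_measurable lborel {0..l} u \<and>
     set_integrable lborel {0..l} (\<lambda>x. (cmod (u x))\<^sup>2)"

definition L2G :: "'e set \<Rightarrow> ('e \<Rightarrow> real) \<Rightarrow> ('e \<Rightarrow> real \<Rightarrow> complex) \<Rightarrow> bool" where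
  "L2G E len f \<longleftrightarrow> (\<forall>e\<in>E. sq_int (len e) (f e)) \<and>
     (\<lambda>e. LINT x:{0..len e}|lborel. (cmod (f e x))\<^sup>2) summable_on E"

definition ipG :: "'e set \<Rightarrow> ('e \<Rightarrow> real) \<Rightarrow> ('e \<Rightarrow> real \<Rightarrow> complex) \<Rightarrow> ('e \<Rightarrow> real \<Rightarrow> complex) \<Rightarrow> complex" where
  "ipG E len f g = (\<Sum>\<^sub>\<infinity>e\<in>E. LINT x:{0..len e}|lborel. f e x * cnj (g e x))"

definition aeq :: "'e set \<Rightarrow> ('e \<Rightarrow> real) \<Rightarrow> ('e \<Rightarrow> real \<Rightarrow> complex) \<Rightarrow> ('e \<Rightarrow> real \<Rightarrow> complex) \<Rightarrow> bool" where
  "aeq E len f g \<longleftrightarrow> (\<forall>e\<in>E. AE x in lborel. x \<in> {0..len e} \<longrightarrow> f e x = g e x)"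

text \<open>Sobolev space W^{2,2}(0,l) (continuous representative on the closed interval):
  u is C^1 on [0,l] with derivative u', u' is absolutely continuous with
  u'(x) = u'(0) + int_0^x u'', and the second derivative u'' is square integrable.\<close>
definition W22 :: "real \<Rightarrow> (real \<Rightarrow> complex) \<Rightarrow> (real \<Rightarrow> complex) \<Rightarrow> (real \<Rightarrow> complex) \<Rightarrow> bool" where
  "W22 l u u' u'' \<longleftrightarrow>
     (\<forall>x\<in>{0..l}. (u has_vector_derivative u' x) (at x within {0..l})) \<and>
     sq_int l u'' \<and> set_integrable lborel {0..l} u'' \<and>
     (\<forall>x\<in>{0..l}. u' x = u' 0 + (LINT t:{0..x}|lborel. u'' t))"

text \<open>Graph of H_max: Hmax E len f h means f \<in> dom(H_max) and H_max f = h (in L^2(G)),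
  i.e. f_e \<in> W^{2,2}(e) with -f_e'' = h_e a.e., and sum (||f_e||^2 + ||f_e''||^2) < infinity.\<close>
definition Hmax :: "'e set \<Rightarrow> ('e \<Rightarrow> real) \<Rightarrow> ('e \<Rightarrow> real \<Rightarrow> complex) \<Rightarrow> ('e \<Rightarrow> real \<Rightarrow> complex) \<Rightarrow> bool" where
  "Hmax E len f h \<longleftrightarrow> L2G E len f \<and> L2G E len h \<and>
     (\<forall>e\<in>E. \<exists>u'. W22 (len e) (f e) u' (\<lambda>x. - h e x))"

definition dv :: "real \<Rightarrow> (real \<Rightarrow> complex) \<Rightarrow> real \<Rightarrow> complex" where
  "dv l u x = vector_derivative u (at x within {0..l})"

text \<open>Graph of H_min: the restriction of H_max to W^{2,2}_0, i.e. functions with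
  f_e and f_e' vanishing at both endpoints of every edge.\<close>
definition Hmin :: "'e set \<Rightarrow> ('e \<Rightarrow> real) \<Rightarrow> ('e \<Rightarrow> real \<Rightarrow> complex) \<Rightarrow> ('e \<Rightarrow> real \<Rightarrow> complex) \<Rightarrow> bool" where
  "Hmin E len f h \<longleftrightarrow> Hmax E len f h \<and>
     (\<forall>e\<in>E. f e 0 = 0 \<and> f e (len e) = 0 \<and> dv (len e) (f e) 0 = 0 \<and> dv (len e) (f e) (len e) = 0)"

definition inBS :: "'e set \<Rightarrow> ('e \<Rightarrow> complex \<times> complex) \<Rightarrow> bool" where
  "inBS E \<phi> \<longleftrightarrow> (\<lambda>e. (cmod (fst (\<phi> e)))\<^sup>2 + (cmod (snd (\<phi> e)))\<^sup>2) summable_on E"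

definition ipBS :: "'e set \<Rightarrow> ('e \<Rightarrow> complex \<times> complex) \<Rightarrow> ('e \<Rightarrow> complex \<times> complex) \<Rightarrow> complex" where
  "ipBS E \<phi> \<psi> = (\<Sum>\<^sub>\<infinity>e\<in>E. fst (\<phi> e) * cnj (fst (\<psi> e)) + snd (\<phi> e) * cnj (snd (\<psi> e)))"

text \<open>Boundary maps. f_e'(e_o) = f_e'(0), f_e'(e_i) = - f_e'(|e|).\<close>
definition Gamma0 :: "('e \<Rightarrow> real) \<Rightarrow> ('e \<Rightarrow> real \<Rightarrow> complex) \<Rightarrow> 'e \<Rightarrow> complex \<times> complex" where
  "Gamma0 len f e = (of_real (sqrt (len e)) * f e 0, of_real (sqrt (len e)) * f e (len e))"

definition Gamma1 :: "('e \<Rightarrow> real) \<Rightarrow> ('e \<Rightarrow> real \<Rightarrow> complex) \<Rightarrow> 'e \<Rightarrow> complex \<times> complex" where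
  "Gamma1 len f e =
    (let l = len e; a = f e 0; b = f e l;
         da = dv l (f e) 0; db = - dv l (f e) l;
         c = of_real (l powr (-3/2))
     in (c * (of_real l * da + a - b), c * (of_real l * db - a + b)))"

definition Me :: "real \<Rightarrow> complex \<Rightarrow> complex \<times> complex \<Rightarrow> complex \<times> complex" where
  "Me l z v =
    (let s = csqrt z; w = of_real l * s;
         ct = cos w / sin w; cs = 1 / sin w; il = of_real (1 / l);
         m11 = il * (s * (- ct) - il * (-1));
         m12 = il * (s * cs - il * 1)
     in (m11 * fst v + m12 * snd v, m12 * fst v + m11 * snd v))"

end

(* On an edge everything follows from the bilinear Green identity
     int u'' v - int u v'' = [u' v - u v'] from 0 to l,
   tested against explicit functions v: the cubic Hermite basis gives the trace estimates and the
   surjectivity of the boundary maps, 1 and x give the regularized derivatives in Gamma1, and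
   sin (sqrt z x), sin (sqrt z (l - x)) give the Weyl function. All constants depend only on z
   and an upper bound for l, so the edgewise results can be summed. For the adjoint, a weak solution
   differs from a particular W22 solution by a function whose component orthogonal to 1 and x
   is itself an admissible test datum, hence zero. *)
theory Submission
  imports Defs
begin

section \<open>Square-integrable functions and integration by parts\<close>

text \<open>The edge lengths may accumulate at 0, and this dictates the weights of the boundary
  maps. Boundary values times \<open>sqrt l\<close> are bounded by the L2 norms of f and f'' with
  constants that stay bounded as l tends to 0. A derivative at an endpoint is not controlled by f''
  alone, since affine functions have a slope but no second derivative. Subtracting the difference
  quotient removes exactly the affine part; the remainder is at most l^(3/2) times the norm of f'',
  which the weight \<open>l powr (-3/2)\<close> cancels. The subtraction does no harm to Green's
  identity: on an edge, \<open>Gamma1\<close> is l^(-1/2) times the inward derivatives plus l^(-2) Q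
  \<open>Gamma0\<close>, where Q is the real symmetric matrix with rows (1,-1) and (-1,1), so its
  contribution to the difference of boundary forms is zero. The upper bound on the lengths controls
  the positive powers of l that remain. Elements of L2 are represented by functions, not classes, so
  the adjoint and the uniqueness of eigenfunctions are stated up to \<open>aeq\<close>.\<close>

lemma set_borel_measurable_mult:
  fixes u v :: "real \<Rightarrow> complex"
  assumes "set_borel_measurable M A u" "set_borel_measurable M A v"
  shows "set_borel_measurable M A (\<lambda>x. u x * v x)"
proof -
  have "(\<lambda>x. (indicator A x *\<^sub>R u x) * (indicator A x *\<^sub>R v x)) \<in> borel_measurable M"
    using assms unfolding set_borel_measurable_def by (rule borel_measurable_times)
  moreover have "(\<lambda>x. (indicator A x *\<^sub>R u x) * (indicator A x *\<^sub>R v x)) =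
      (\<lambda>x. indicator A x *\<^sub>R (u x * v x))"
    by (auto simp: indicator_def)
  ultimately show ?thesis unfolding set_borel_measurable_def by simp
qed

lemma set_borel_measurable_add:
  fixes u v :: "real \<Rightarrow> complex"
  assumes "set_borel_measurable M A u" "set_borel_measurable M A v"
  shows "set_borel_measurable M A (\<lambda>x. u x + v x)"
  using borel_measurable_add[OF assms[unfolded set_borel_measurable_def]]
  unfolding set_borel_measurable_def by (simp add: scaleR_add_right)

lemma set_borel_measurable_cnj:
  fixes u :: "real \<Rightarrow> complex"
  assumes "set_borel_measurable M A u"
  shows "set_borel_measurable M A (\<lambda>x. cnj (u x))"
proof -
  have "(\<lambda>x. cnj (indicator A x *\<^sub>R u x)) \<in> borel_measurable M"
    using assms unfolding set_borel_measurable_def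
    by (intro borel_measurable_continuous_on[where f = cnj] continuous_intros)
  moreover have "(\<lambda>x. cnj (indicator A x *\<^sub>R u x)) = (\<lambda>x. indicator A x *\<^sub>R cnj (u x))"
    by (auto simp: indicator_def)
  ultimately show ?thesis unfolding set_borel_measurable_def by simp
qed

lemma set_integrable_continuous:
  fixes u :: "real \<Rightarrow> 'a::euclidean_space"
  assumes "continuous_on {a..b} u"
  shows "set_integrable lborel {a..b} u"
  using borel_integrable_atLeastAtMost'[OF assms] .

lemma sq_int_continuous:
  assumes "continuous_on {0..l} u"
  shows "sq_int l u"
proof -
  have "set_borel_measurable lborel {0..l} u"
    using borel_measurable_continuous_on_indicator[OF _ assms]
    by (simp add: set_borel_measurable_def)
  moreover have "set_integrable lborel {0..l} (\<lambda>x. (cmod (u x))\<^sup>2)"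
    by (intro set_integrable_continuous continuous_intros assms)
  ultimately show ?thesis by (simp add: sq_int_def)
qed

lemma norm_mult_le_sum_squares: "cmod (a * b) \<le> (cmod a)\<^sup>2 + (cmod b)\<^sup>2"
proof -
  have "2 * (cmod a * cmod b) \<le> (cmod a)\<^sup>2 + (cmod b)\<^sup>2"
    using sum_squares_bound[of "cmod a" "cmod b"] by simp
  moreover have "0 \<le> cmod a * cmod b" by simp
  ultimately show ?thesis unfolding norm_mult by linarith
qed

lemma sq_int_mult_integrable:
  assumes "sq_int l u" "sq_int l v"
  shows "set_integrable lborel {0..l} (\<lambda>x. u x * v x)"
proof (rule set_integrable_bound)
  show "set_integrable lborel {0..l} (\<lambda>x. (cmod (u x))\<^sup>2 + (cmod (v x))\<^sup>2)"
    using assms by (auto simp: sq_int_def)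
  show "set_borel_measurable lborel {0..l} (\<lambda>x. u x * v x)"
    using assms by (auto simp: sq_int_def intro: set_borel_measurable_mult)
  show "AE x in lborel. x \<in> {0..l} \<longrightarrow> cmod (u x * v x) \<le> norm ((cmod (u x))\<^sup>2 + (cmod (v x))\<^sup>2)"
    using norm_mult_le_sum_squares by auto
qed

text \<open>The interval is bounded, so the constant 1 is square integrable and can serve as the
  second factor of a product.\<close>

lemma sq_int_integrable: "sq_int l u \<Longrightarrow> set_integrable lborel {0..l} u"
  using sq_int_mult_integrable[of l u "\<lambda>_. 1"] sq_int_continuous[of l "\<lambda>_. 1"] by simp

lemma sq_int_cmult:
  assumes "sq_int l u"
  shows "sq_int l (\<lambda>x. c * u x)"
  using assms set_borel_measurable_mult[of lborel "{0..l}" "\<lambda>_. c" u]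
    sq_int_continuous[of l "\<lambda>_. c"]
  by (auto simp: sq_int_def norm_mult power_mult_distrib)

lemma sq_int_uminus: "sq_int l u \<Longrightarrow> sq_int l (\<lambda>x. - u x)"
  using sq_int_cmult[of l u "-1"] by simp

lemma sq_int_cnj: "sq_int l u \<Longrightarrow> sq_int l (\<lambda>x. cnj (u x))"
  by (auto simp: sq_int_def set_borel_measurable_cnj)

lemma sq_int_add:
  assumes "sq_int l u" "sq_int l v"
  shows "sq_int l (\<lambda>x. u x + v x)"
proof -
  have m: "set_borel_measurable lborel {0..l} (\<lambda>x. u x + v x)"
    using assms by (auto simp: sq_int_def intro: set_borel_measurable_add)
  have "set_integrable lborel {0..l} (\<lambda>x. (cmod (u x + v x))\<^sup>2)"
  proof (rule set_integrable_bound)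
    show "set_integrable lborel {0..l} (\<lambda>x. 2 * ((cmod (u x))\<^sup>2 + (cmod (v x))\<^sup>2))"
      using assms by (auto simp: sq_int_def)
    have "(\<lambda>x. (cmod (indicator {0..l} x *\<^sub>R (u x + v x)))\<^sup>2) \<in> borel_measurable lborel"
      using m unfolding set_borel_measurable_def by measurable
    moreover have "(\<lambda>x. (cmod (indicator {0..l} x *\<^sub>R (u x + v x)))\<^sup>2)
        = (\<lambda>x. indicator {0..l} x *\<^sub>R (cmod (u x + v x))\<^sup>2)"
      by (auto simp: indicator_def)
    ultimately show "set_borel_measurable lborel {0..l} (\<lambda>x. (cmod (u x + v x))\<^sup>2)"
      unfolding set_borel_measurable_def by simp
    have "(cmod (a + b))\<^sup>2 \<le> 2 * ((cmod a)\<^sup>2 + (cmod b)\<^sup>2)" for a b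
    proof -
      have "(cmod (a + b))\<^sup>2 \<le> (cmod a + cmod b)\<^sup>2"
        by (intro power_mono norm_triangle_ineq) auto
      then show ?thesis using sum_squares_bound[of "cmod a" "cmod b"]
        by (simp add: power2_sum)
    qed
    then show "AE x in lborel. x \<in> {0..l} \<longrightarrow>
       norm ((cmod (u x + v x))\<^sup>2) \<le> norm (2 * ((cmod (u x))\<^sup>2 + (cmod (v x))\<^sup>2))"
      by (auto simp: abs_mult)
  qed
  with m show ?thesis by (simp add: sq_int_def)
qed

lemma sq_int_diff: "sq_int l u \<Longrightarrow> sq_int l v \<Longrightarrow> sq_int l (\<lambda>x. u x - v x)"
  using sq_int_add[OF _ sq_int_uminus, of l u v] by simp

lemma sq_int_norm: "sq_int l u \<Longrightarrow> set_integrable lborel {0..l} (\<lambda>x. cmod (u x))"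
  by (intro set_integrable_norm sq_int_integrable)

lemma set_lebesgue_integral_const_real:
  "0 \<le> (l::real) \<Longrightarrow> (LINT x:{0..l}|lborel. (c::real)) = l * c"
  by (simp add: set_integral_const)

text \<open>Cauchy-Schwarz against the constant 1, in variance form: with \<open>m\<close> the mean
  of |u|, the integral of (|u| - m)^2 is non-negative and is expanded.\<close>

lemma square_integral_norm_le:
  assumes l: "0 < l" and u: "sq_int l u"
  shows "(LINT x:{0..l}|lborel. cmod (u x))\<^sup>2 \<le> l * (LINT x:{0..l}|lborel. (cmod (u x))\<^sup>2)"
proof -
  define I where "I = (LINT x:{0..l}|lborel. cmod (u x))"
  define m where "m = I / l"
  have i1: "set_integrable lborel {0..l} (\<lambda>x. cmod (u x))" by (rule sq_int_norm[OF u])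
  have i2: "set_integrable lborel {0..l} (\<lambda>x. (cmod (u x))\<^sup>2)" using u by (simp add: sq_int_def)
  have i3: "set_integrable lborel {0..l} (\<lambda>x. m\<^sup>2)"
    by (intro set_integrable_continuous continuous_intros)
  have "0 \<le> (LINT x:{0..l}|lborel. (cmod (u x))\<^sup>2 - 2 * m * cmod (u x) + m\<^sup>2)"
  proof -
    have "0 \<le> (cmod (u x))\<^sup>2 - 2 * m * cmod (u x) + m\<^sup>2" for x
      using zero_le_power2[of "cmod (u x) - m"] by (simp add: power2_diff mult_ac)
    then show ?thesis unfolding set_lebesgue_integral_def
      by (intro Bochner_Integration.integral_nonneg) (auto simp: indicator_def)
  qed
  also have "\<dots> = (LINT x:{0..l}|lborel. (cmod (u x))\<^sup>2) - 2 * m * I + l * m\<^sup>2"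
    using i1 i2 i3 l by (simp add: set_lebesgue_integral_const_real I_def)
  also have "\<dots> = (LINT x:{0..l}|lborel. (cmod (u x))\<^sup>2) - I\<^sup>2 / l"
    using l by (simp add: m_def field_simps power2_eq_square)
  finally show ?thesis using l by (simp add: I_def field_simps)
qed

text \<open>Taking the second factor in sup norm leaves an explicit \<open>sqrt l\<close>. It is
  such powers of l that the weights of the boundary maps have to compensate.\<close>

lemma integral_mult_bounded_le:
  assumes l: "0 < l" and u: "sq_int l u" and g: "continuous_on {0..l} g"
    and B: "\<And>x. x \<in> {0..l} \<Longrightarrow> cmod (g x) \<le> B"
  shows "cmod (LINT x:{0..l}|lborel. u x * g x) \<le>
    B * sqrt l * sqrt (LINT x:{0..l}|lborel. (cmod (u x))\<^sup>2)"
proof -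
  have B0: "0 \<le> B" using order_trans[OF norm_ge_zero B[of 0]] l by simp
  have i: "set_integrable lborel {0..l} (\<lambda>x. u x * g x)"
    by (rule sq_int_mult_integrable[OF u sq_int_continuous[OF g]])
  have "cmod (LINT x:{0..l}|lborel. u x * g x) \<le> (LINT x:{0..l}|lborel. cmod (u x * g x))"
    by (rule set_integral_norm_bound[OF i])
  also have "\<dots> \<le> (LINT x:{0..l}|lborel. B * cmod (u x))"
  proof (rule set_integral_mono)
    show "set_integrable lborel {0..l} (\<lambda>x. cmod (u x * g x))"
      by (rule set_integrable_norm[OF i])
    show "set_integrable lborel {0..l} (\<lambda>x. B * cmod (u x))"
      using sq_int_norm[OF u] by simp
    show "cmod (u x * g x) \<le> B * cmod (u x)" if "x \<in> {0..l}" for x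
      using mult_left_mono[OF B[OF that], of "cmod (u x)"] by (simp add: norm_mult mult_ac)
  qed
  also have "\<dots> = B * (LINT x:{0..l}|lborel. cmod (u x))" by simp
  also have "\<dots> \<le> B * (sqrt l * sqrt (LINT x:{0..l}|lborel. (cmod (u x))\<^sup>2))"
    using real_le_rsqrt[OF square_integral_norm_le[OF l u]] B0
    by (intro mult_left_mono) (auto simp: real_sqrt_mult)
  finally show ?thesis by (simp add: mult_ac)
qed

section \<open>Integration by parts against an absolutely continuous function\<close>

lemma integral_FTC_continuous:
  fixes F :: "real \<Rightarrow> complex"
  assumes "a \<le> b" "\<And>x. x \<in> {a..b} \<Longrightarrow> (F has_vector_derivative f x) (at x within {a..b})"
    and "continuous_on {a..b} f"
  shows "(LINT x:{a..b}|lborel. f x) = F b - F a"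
  using integral_FTC_atLeastAtMost[of a b F f] assms by (simp add: set_lebesgue_integral_def)

text \<open>Both sides are iterated integrals of \<open>f t * g s\<close> over the triangle 0 <= t
  <= s <= l. Cutting both factors off by zero outside [0,l] replaces the triangle by the half-plane
  t <= s, so the kernel inherits integrability from a product on the whole plane.\<close>

lemma Fubini_triangle:
  fixes f g :: "real \<Rightarrow> complex"
  assumes f: "set_integrable lborel {0..l} f" and g: "set_integrable lborel {0..l} g"
  shows "(LINT t:{0..l}|lborel. f t * (LINT s:{t..l}|lborel. g s)) =
    (LINT s:{0..l}|lborel. (LINT t:{0..s}|lborel. f t) * g s)"
proof -
  define P where "P = (\<lambda>x. indicator {0..l} x *\<^sub>R f x)"
  define Q where "Q = (\<lambda>x. indicator {0..l} x *\<^sub>R g x)"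
  have P: "integrable lborel P" and Q: "integrable lborel Q"
    using f g by (auto simp: set_integrable_def P_def Q_def)
  note [measurable] = borel_measurable_integrable[OF P] borel_measurable_integrable[OF Q]
  define K where "K = (\<lambda>t s. indicator {p::real \<times> real. fst p \<le> snd p} (t, s) *\<^sub>R (P t * Q s))"
  have i0: "integrable (lborel \<Otimes>\<^sub>M lborel) (\<lambda>(t, s). P t * Q s)"
  proof (rule lborel_pair.Fubini_integrable)
    show "(\<lambda>(t, s). P t * Q s) \<in> borel_measurable (lborel \<Otimes>\<^sub>M lborel)" by measurable
    show "integrable lborel (\<lambda>x. \<integral> y. norm (case (x, y) of (t, s) \<Rightarrow> P t * Q s) \<partial>lborel)"
      using P Q by (simp add: norm_mult)
    show "AE x in lborel. integrable lborel (\<lambda>y. case (x, y) of (t, s) \<Rightarrow> P t * Q s)"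
      using Q by simp
  qed
  have "{p::real \<times> real. fst p \<le> snd p} \<in> sets (lborel \<Otimes>\<^sub>M lborel)"
    unfolding lborel_prod sets_lborel
    by (intro borel_closed closed_Collect_le continuous_intros)
  from integrable_mult_indicator[OF this i0]
  have "integrable (lborel \<Otimes>\<^sub>M lborel) (case_prod K)"
    by (simp add: K_def case_prod_unfold)
  from lborel_pair.Fubini_integral[OF this]
  have eq: "(\<integral>s. (\<integral>t. K t s \<partial>lborel) \<partial>lborel) = (\<integral>t. (\<integral>s. K t s \<partial>lborel) \<partial>lborel)" .
  have inner1: "(\<integral>t. K t s \<partial>lborel) = indicator {0..l} s *\<^sub>R ((LINT t:{0..s}|lborel. f t) * g s)" for s
  proof -
    have "(\<lambda>t. K t s) = (\<lambda>t. (indicator {0..s} t *\<^sub>R f t) * Q s)"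
      by (auto simp: K_def P_def Q_def indicator_def)
    then have "(\<integral>t. K t s \<partial>lborel) = (LINT t:{0..s}|lborel. f t) * Q s"
      unfolding set_lebesgue_integral_def by (simp only: integral_mult_left_zero)
    then show ?thesis by (simp add: Q_def)
  qed
  have inner2: "(\<integral>s. K t s \<partial>lborel) = indicator {0..l} t *\<^sub>R (f t * (LINT s:{t..l}|lborel. g s))" for t
  proof -
    have "(\<lambda>s. K t s) = (\<lambda>s. P t * (indicator {t..l} s *\<^sub>R g s))"
      by (auto simp: K_def P_def Q_def indicator_def)
    then have "(\<integral>s. K t s \<partial>lborel) = P t * (LINT s:{t..l}|lborel. g s)"
      unfolding set_lebesgue_integral_def by (simp only: integral_mult_right_zero)
    then show ?thesis by (simp add: P_def)
  qed
  show ?thesis using eq unfolding inner1 inner2 set_lebesgue_integral_def by simp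
qed

lemma continuous_on_indefinite_integral:
  fixes f :: "real \<Rightarrow> complex"
  assumes f: "set_integrable lborel {0..l} f"
  shows "continuous_on {0..l} (\<lambda>x. LINT t:{0..x}|lborel. f t)"
proof -
  have "continuous_on {0..l} (\<lambda>x. integral {0..x} f)"
    by (intro indefinite_integral_continuous_1 set_borel_integral_eq_integral(1)[OF f])
  moreover have "integral {0..x} f = (LINT t:{0..x}|lborel. f t)" if "x \<in> {0..l}" for x
    by (rule set_borel_integral_eq_integral(2)[symmetric], rule set_integrable_subset[OF f])
       (use that in auto)
  ultimately show ?thesis by (rule continuous_on_eq)
qed

text \<open>\<open>F\<close> is a primitive of \<open>f\<close> only in the integral sense and may
  fail to be differentiable at some points, so the product rule cannot be integrated directly.
  Instead g(l) - g(x) is written as the integral of \<open>g'\<close> over [x,l], and Fubini on the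
  triangle moves the integration onto \<open>f\<close>.\<close>

lemma integration_by_parts_absolutely_continuous:
  fixes f F g :: "real \<Rightarrow> complex"
  assumes l: "0 \<le> l" and f: "set_integrable lborel {0..l} f"
    and F: "\<And>x. x \<in> {0..l} \<Longrightarrow> F x = F 0 + (LINT t:{0..x}|lborel. f t)"
    and g: "\<And>x. x \<in> {0..l} \<Longrightarrow> (g has_vector_derivative g' x) (at x within {0..l})"
    and g': "continuous_on {0..l} g'"
  shows "(LINT x:{0..l}|lborel. f x * g x) = F l * g l - F 0 * g 0 - (LINT x:{0..l}|lborel. F x * g' x)"
proof -
  have gcont: "continuous_on {0..l} g"
    using g by (meson continuous_on_eq_continuous_within has_vector_derivative_continuous)
  have "continuous_on {0..l} (\<lambda>x. F 0 + (LINT t:{0..x}|lborel. f t))"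
    by (intro continuous_intros continuous_on_indefinite_integral f)
  then have Fcont: "continuous_on {0..l} F" by (rule continuous_on_eq) (metis F)
  have ift: "(LINT s:{t..l}|lborel. g' s) = g l - g t" if "t \<in> {0..l}" for t
  proof (rule integral_FTC_continuous)
    show "(g has_vector_derivative g' x) (at x within {t..l})" if "x \<in> {t..l}" for x
      using that \<open>t \<in> {0..l}\<close> by (intro has_vector_derivative_within_subset[OF g]) auto
  qed (use that g' in \<open>auto intro: continuous_on_subset\<close>)
  have ig': "set_integrable lborel {0..l} g'" by (rule set_integrable_continuous[OF g'])
  have ifg: "set_integrable lborel {0..l} (\<lambda>x. f x * g x)"
  proof -
    from compact_imp_bounded[OF compact_continuous_image[OF gcont compact_Icc]]
    obtain B where "\<forall>y\<in>g ` {0..l}. cmod y \<le> B" unfolding bounded_iff by blast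
    then have B: "\<And>x. x \<in> {0..l} \<Longrightarrow> cmod (g x) \<le> B" by blast
    show ?thesis
    proof (rule set_integrable_bound)
      show "set_integrable lborel {0..l} (\<lambda>x. of_real B * f x)" using f by simp
      show "set_borel_measurable lborel {0..l} (\<lambda>x. f x * g x)"
        using f sq_int_continuous[OF gcont]
        by (intro set_borel_measurable_mult)
          (auto simp: set_integrable_def set_borel_measurable_def sq_int_def)
      show "AE x in lborel. x \<in> {0..l} \<longrightarrow> cmod (f x * g x) \<le> cmod (of_real B * f x)"
      proof (intro AE_I2 impI)
        fix x assume "x \<in> {0..l}"
        then have "cmod (g x) \<le> \<bar>B\<bar>" using B by force
        then show "cmod (f x * g x) \<le> cmod (of_real B * f x)"
          using mult_right_mono[of "cmod (g x)" "\<bar>B\<bar>" "cmod (f x)"] by (simp add: norm_mult mult.commute)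
      qed
    qed
  qed
  have iFg: "set_integrable lborel {0..l} (\<lambda>x. F x * g' x)"
    by (intro set_integrable_continuous continuous_intros Fcont g')
  have "(LINT x:{0..l}|lborel. f x * g l) - (LINT x:{0..l}|lborel. f x * g x)
      = (LINT x:{0..l}|lborel. f x * g l - f x * g x)"
    using f ifg by simp
  also have "\<dots> = (LINT x:{0..l}|lborel. f x * (LINT s:{x..l}|lborel. g' s))"
    by (intro set_lebesgue_integral_cong) (auto simp: ift algebra_simps)
  also have "\<dots> = (LINT s:{0..l}|lborel. (LINT t:{0..s}|lborel. f t) * g' s)"
    by (rule Fubini_triangle[OF f ig'])
  also have "\<dots> = (LINT s:{0..l}|lborel. F s * g' s - F 0 * g' s)"
  proof (intro set_lebesgue_integral_cong allI impI)
    fix x assume "x \<in> {0..l}"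
    from F[OF this] show "(LINT t:{0..x}|lborel. f t) * g' x = F x * g' x - F 0 * g' x"
      by (simp add: ring_distribs)
  qed simp
  also have "\<dots> = (LINT s:{0..l}|lborel. F s * g' s) - F 0 * (g l - g 0)"
    using ift[of 0] l iFg ig' by simp
  finally have "(F l - F 0) * g l - (LINT x:{0..l}|lborel. f x * g x)
      = (LINT s:{0..l}|lborel. F s * g' s) - F 0 * (g l - g 0)"
    using F[of l] l by simp
  then show ?thesis by (simp add: algebra_simps)
qed

section \<open>The Sobolev space and Green's identity on an edge\<close>

lemma
  assumes "W22 l u u' u''"
  shows W22_has_derivative: "x \<in> {0..l} \<Longrightarrow> (u has_vector_derivative u' x) (at x within {0..l})"
    and W22_sq_int2: "sq_int l u''"
    and W22_integrable2: "set_integrable lborel {0..l} u''"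
    and W22_deriv_eq: "x \<in> {0..l} \<Longrightarrow> u' x = u' 0 + (LINT t:{0..x}|lborel. u'' t)"
  using assms unfolding W22_def by blast+

lemma W22_deriv_continuous:
  assumes "W22 l u u' u''"
  shows "continuous_on {0..l} u'"
proof -
  have "continuous_on {0..l} (\<lambda>x. u' 0 + (LINT t:{0..x}|lborel. u'' t))"
    using assms by (intro continuous_intros continuous_on_indefinite_integral W22_integrable2)
  then show ?thesis
    by (rule continuous_on_eq) (rule W22_deriv_eq[OF assms, symmetric])
qed

lemma W22_continuous:
  assumes "W22 l u u' u''"
  shows "continuous_on {0..l} u"
  using W22_has_derivative[OF assms]
  by (meson continuous_on_eq_continuous_within has_vector_derivative_continuous)

lemma W22_sq_int: "W22 l u u' u'' \<Longrightarrow> sq_int l u"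
  by (intro sq_int_continuous W22_continuous)

lemma W22_dv:
  assumes "0 < l" "W22 l u u' u''" "x \<in> {0..l}"
  shows "dv l u x = u' x"
  unfolding dv_def using assms
  by (intro vector_derivative_within_closed_interval W22_has_derivative)

text \<open>Moving one derivative in each integral leaves the same integral of u' v', which cancels.
  There is no conjugate, so for two eigenfunctions with the same complex z the left side vanishes;
  the sesquilinear form follows through \<open>W22_cnj\<close>.\<close>

lemma W22_Green:
  assumes l: "0 \<le> l" and u: "W22 l u u' u''" and v: "W22 l v v' v''"
  shows "(LINT x:{0..l}|lborel. u'' x * v x) - (LINT x:{0..l}|lborel. u x * v'' x)
    = u' l * v l - u' 0 * v 0 - u l * v' l + u 0 * v' 0"
proof -
  have "(LINT x:{0..l}|lborel. u'' x * v x) = u' l * v l - u' 0 * v 0 - (LINT x:{0..l}|lborel. u' x * v' x)"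
    by (rule integration_by_parts_absolutely_continuous[OF l W22_integrable2[OF u] W22_deriv_eq[OF u]
          W22_has_derivative[OF v] W22_deriv_continuous[OF v]])
  moreover have "(LINT x:{0..l}|lborel. v'' x * u x) = v' l * u l - v' 0 * u 0 - (LINT x:{0..l}|lborel. v' x * u' x)"
    by (rule integration_by_parts_absolutely_continuous[OF l W22_integrable2[OF v] W22_deriv_eq[OF v]
          W22_has_derivative[OF u] W22_deriv_continuous[OF u]])
  ultimately show ?thesis by (simp add: mult.commute)
qed

lemma set_integral_cnj: "(LINT x:A|M. cnj (u x)) = cnj (LINT x:A|M. u x)"
  using Bochner_Integration.integral_cnj[of M "\<lambda>x. indicator A x *\<^sub>R u x"] by (simp add: set_lebesgue_integral_def)

lemma W22_cnj:
  assumes "W22 l u u' u''"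
  shows "W22 l (\<lambda>x. cnj (u x)) (\<lambda>x. cnj (u' x)) (\<lambda>x. cnj (u'' x))"
  unfolding W22_def
proof (intro conjI ballI)
  fix x assume x: "x \<in> {0..l}"
  show "((\<lambda>x. cnj (u x)) has_vector_derivative cnj (u' x)) (at x within {0..l})"
    by (rule has_vector_derivative_cnj[OF W22_has_derivative[OF assms x]])
  from W22_deriv_eq[OF assms x] show "cnj (u' x) = cnj (u' 0) + (LINT t:{0..x}|lborel. cnj (u'' t))"
    unfolding set_integral_cnj by (metis complex_cnj_add)
qed (intro sq_int_cnj sq_int_integrable W22_sq_int2[OF assms])+

lemma W22_add:
  assumes "W22 l u u' u''" "W22 l v v' v''"
  shows "W22 l (\<lambda>x. u x + v x) (\<lambda>x. u' x + v' x) (\<lambda>x. u'' x + v'' x)"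
  unfolding W22_def
proof (intro conjI ballI)
  fix x assume x: "x \<in> {0..l}"
  show "((\<lambda>x. u x + v x) has_vector_derivative u' x + v' x) (at x within {0..l})"
    by (intro has_vector_derivative_add W22_has_derivative[OF assms(1) x] W22_has_derivative[OF assms(2) x])
  note * = W22_deriv_eq[OF assms(1) x] W22_deriv_eq[OF assms(2) x]
  have "set_integrable lborel {0..x} u''" "set_integrable lborel {0..x} v''"
    using x by (auto intro: set_integrable_subset[OF W22_integrable2[OF assms(1)]]
        set_integrable_subset[OF W22_integrable2[OF assms(2)]])
  then have "(LINT t:{0..x}|lborel. u'' t + v'' t)
      = (LINT t:{0..x}|lborel. u'' t) + (LINT t:{0..x}|lborel. v'' t)" by simp
  with arg_cong2[OF *, of "(+)"] show "u' x + v' x = u' 0 + v' 0 + (LINT t:{0..x}|lborel. u'' t + v'' t)"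
    by (simp only: add_ac)
qed (intro sq_int_add sq_int_integrable W22_sq_int2[OF assms(1)] W22_sq_int2[OF assms(2)])+

lemma W22_cmult:
  assumes "W22 l u u' u''"
  shows "W22 l (\<lambda>x. c * u x) (\<lambda>x. c * u' x) (\<lambda>x. c * u'' x)"
  unfolding W22_def
proof (intro conjI ballI)
  fix x assume x: "x \<in> {0..l}"
  show "((\<lambda>x. c * u x) has_vector_derivative c * u' x) (at x within {0..l})"
    by (intro has_vector_derivative_mult_right W22_has_derivative[OF assms x])
  show "c * u' x = c * u' 0 + (LINT t:{0..x}|lborel. c * u'' t)"
    unfolding set_integral_mult_right distrib_left[symmetric] W22_deriv_eq[OF assms x, symmetric] ..
qed (intro sq_int_cmult sq_int_integrable W22_sq_int2[OF assms])+

lemma W22_diff: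
  assumes "W22 l u u' u''" "W22 l v v' v''"
  shows "W22 l (\<lambda>x. u x - v x) (\<lambda>x. u' x - v' x) (\<lambda>x. u'' x - v'' x)"
  using W22_add[OF assms(1) W22_cmult[OF assms(2), of "-1"]] by simp

lemma W22_C2:
  assumes "\<And>x. x \<in> {0..l} \<Longrightarrow> (u has_vector_derivative u' x) (at x within {0..l})"
    and "\<And>x. x \<in> {0..l} \<Longrightarrow> (u' has_vector_derivative u'' x) (at x within {0..l})"
    and "continuous_on {0..l} u''"
  shows "W22 l u u' u''"
  unfolding W22_def
proof (intro conjI ballI)
  fix x assume x: "x \<in> {0..l}"
  have "(LINT t:{0..x}|lborel. u'' t) = u' x - u' 0"
  proof (rule integral_FTC_continuous)
    show "(u' has_vector_derivative u'' t) (at t within {0..x})" if "t \<in> {0..x}" for t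
      using x that by (intro has_vector_derivative_within_subset[OF assms(2)]) auto
    show "continuous_on {0..x} u''" using x by (auto intro: continuous_on_subset[OF assms(3)])
  qed (use x in auto)
  then show "u' x = u' 0 + (LINT t:{0..x}|lborel. u'' t)" by simp
qed (use assms in \<open>auto intro: sq_int_continuous set_integrable_continuous\<close>)

lemma W22_of_real:
  fixes p p' p'' :: "real \<Rightarrow> real"
  assumes "\<And>x. (p has_real_derivative p' x) (at x)"
    and "\<And>x. (p' has_real_derivative p'' x) (at x)"
    and "continuous_on UNIV p''"
  shows "W22 l (\<lambda>x. of_real (p x)) (\<lambda>x. of_real (p' x)) (\<lambda>x. of_real (p'' x))"
proof (rule W22_C2)
  show "continuous_on {0..l} (\<lambda>x. complex_of_real (p'' x))"
    by (intro continuous_intros continuous_on_subset[OF assms(3)]) auto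
next
  fix x
  have "(p has_vector_derivative p' x) (at x within {0..l})" "(p' has_vector_derivative p'' x) (at x within {0..l})"
    using assms(1,2) by (blast intro: has_vector_derivative_at_within
        has_real_derivative_iff_has_vector_derivative[THEN iffD1])+
  then show "((\<lambda>x. of_real (p x)) has_vector_derivative complex_of_real (p' x)) (at x within {0..l})"
    "((\<lambda>x. of_real (p' x)) has_vector_derivative complex_of_real (p'' x)) (at x within {0..l})"
    by (blast intro: bounded_linear.has_vector_derivative[OF bounded_linear_of_real])+
qed

lemma W22_affine: "W22 l (\<lambda>x. c + d * of_real x) (\<lambda>_. d) (\<lambda>_. 0)"
proof -
  have 1: "W22 l (\<lambda>x. of_real 1) (\<lambda>_. of_real 0) (\<lambda>_. of_real 0)"
    by (rule W22_of_real) (auto intro!: derivative_eq_intros)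
  have 2: "W22 l (\<lambda>x. of_real x) (\<lambda>_. of_real 1) (\<lambda>_. of_real 0)"
    by (rule W22_of_real) (auto intro!: derivative_eq_intros)
  show ?thesis using W22_add[OF W22_cmult[OF 1, of c] W22_cmult[OF 2, of d]] by simp
qed

lemma W22_initial_value:
  assumes l: "0 \<le> l" and h: "sq_int l h"
  obtains u u' where "W22 l u u' h" "u 0 = a" "u' 0 = b"
proof -
  define u' where "u' = (\<lambda>x. b + (LINT t:{0..x}|lborel. h t))"
  have hi: "set_integrable lborel {0..l} h" by (rule sq_int_integrable[OF h])
  have cont: "continuous_on {0..l} u'"
    unfolding u'_def by (intro continuous_intros continuous_on_indefinite_integral hi)
  have "set_integrable lborel {0..0} h" using hi l by (auto intro: set_integrable_subset)
  then have u'0: "u' 0 = b"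
    using set_borel_integral_eq_integral(2)[of "{0..0}" h] by (simp add: u'_def)
  \<comment> \<open>The outer primitive is taken with the gauge integral: \<open>u'\<close> is
    continuous, and \<open>integral_has_vector_derivative\<close> then differentiates it on the
    closed interval, endpoints included.\<close>
  have "W22 l (\<lambda>x. a + integral {0..x} u') u' h"
    unfolding W22_def
  proof (intro conjI ballI)
    fix x assume x: "x \<in> {0..l}"
    show "((\<lambda>x. a + integral {0..x} u') has_vector_derivative u' x) (at x within {0..l})"
      using has_vector_derivative_add[OF has_vector_derivative_const
          integral_has_vector_derivative[OF cont x], of a] by simp
    show "u' x = u' 0 + (LINT t:{0..x}|lborel. h t)"
      unfolding u'0 by (simp add: u'_def)
  qed (use h hi in auto)
  then show thesis by (rule that) (simp_all add: u'0)
qed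

section \<open>Boundary values controlled by L2 norms\<close>

definition nrm2 :: "real \<Rightarrow> (real \<Rightarrow> complex) \<Rightarrow> real" where
  "nrm2 l u = (LINT x:{0..l}|lborel. (cmod (u x))\<^sup>2)"

lemma nrm2_nonneg: "0 \<le> nrm2 l u"
  unfolding nrm2_def set_lebesgue_integral_def
  by (intro Bochner_Integration.integral_nonneg) auto

text \<open>Choosing \<open>v\<close> selects a linear functional of the four boundary data of
  \<open>u\<close>, and sup bounds on \<open>v\<close> and \<open>v''\<close> estimate it. The trace
  and defect estimates below are all instances.\<close>

lemma W22_boundary_value_bound:
  assumes l: "0 < l" and u: "W22 l u u' u''" and v: "W22 l v v' v''"
    and c: "continuous_on {0..l} v''"
    and b0: "\<And>x. x \<in> {0..l} \<Longrightarrow> cmod (v x) \<le> B"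
    and b2: "\<And>x. x \<in> {0..l} \<Longrightarrow> cmod (v'' x) \<le> C"
  shows "cmod (u' l * v l - u' 0 * v 0 - u l * v' l + u 0 * v' 0)
    \<le> B * sqrt l * sqrt (nrm2 l u'') + C * sqrt l * sqrt (nrm2 l u)"
  unfolding nrm2_def W22_Green[OF less_imp_le[OF l] u v, symmetric]
  using integral_mult_bounded_le[OF l W22_sq_int2[OF u] W22_continuous[OF v] b0]
    integral_mult_bounded_le[OF l W22_sq_int[OF u] c b2]
  by (intro order_trans[OF norm_triangle_ineq4]) auto

text \<open>With t = x/l in [0,1], the two cubics are l t (1-t)^2 and l t^2 (1-t), and the two
  linear expressions are their second derivatives (6t-4)/l and (2-6t)/l.\<close>

lemma cubic_bound:
  fixes x l c :: real
  assumes "0 < l" "c = 1 / l" "0 \<le> x" "x \<le> l"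
  shows "\<bar>x - 2 * c * x^2 + c^2 * x^3\<bar> \<le> l" "\<bar>c * x^2 - c^2 * x^3\<bar> \<le> l"
    "\<bar>6 * c^2 * x - 4 * c\<bar> \<le> 4 / l" "\<bar>2 * c - 6 * c^2 * x\<bar> \<le> 4 / l"
proof -
  define t where "t = x / l"
  have x: "x = t * l" and t: "0 \<le> t" "t \<le> 1" using assms by (auto simp: t_def field_simps)
  have cl: "c * l = 1" "c > 0" using assms by auto
  have "x - 2 * c * x^2 + c^2 * x^3 = l * t * (1 - 2 * t * (c * l) + t^2 * (c * l)^2)"
    by (simp add: x algebra_simps power2_eq_square power3_eq_cube)
  also have "\<dots> = l * (t * (1 - t)\<^sup>2)" unfolding cl by (simp add: power2_diff mult_ac)
  finally have 1: "x - 2 * c * x^2 + c^2 * x^3 = l * (t * (1 - t)\<^sup>2)" .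
  have "c * x^2 - c^2 * x^3 = l * t^2 * ((c * l) - t * (c * l)^2)"
    by (simp add: x algebra_simps power2_eq_square power3_eq_cube)
  then have 2: "c * x^2 - c^2 * x^3 = l * (t\<^sup>2 * (1 - t))" unfolding cl by simp
  have "6 * c^2 * x = 6 * c * t * (c * l)" by (simp add: x power2_eq_square)
  then have 3: "6 * c^2 * x = c * (6 * t)" unfolding cl by simp
  have "(1 - t)\<^sup>2 \<le> 1" using t by (simp add: power_le_one)
  then have "t * (1 - t)\<^sup>2 \<le> 1" using t by (intro mult_le_one) auto
  then show "\<bar>x - 2 * c * x^2 + c^2 * x^3\<bar> \<le> l"
    unfolding 1 using assms t by (simp add: abs_mult)
  have "t\<^sup>2 * (1 - t) \<le> 1" using t by (intro mult_le_one) (auto simp: power_le_one)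
  then show "\<bar>c * x^2 - c^2 * x^3\<bar> \<le> l"
    unfolding 2 using assms t by (simp add: abs_mult)
  have "c * (6 * t) \<le> c * 6" "0 \<le> c * (6 * t)" using t cl by auto
  then show "\<bar>6 * c^2 * x - 4 * c\<bar> \<le> 4 / l" "\<bar>2 * c - 6 * c^2 * x\<bar> \<le> 4 / l"
    unfolding 3 abs_le_iff using cl(2) assms(2) by auto
qed

text \<open>These are the Hermite basis functions dual to the two inward derivatives, hence
  \<open>w' l = -1\<close>. They are used twice: as test functions in Green's identity, where they
  isolate u(0) and u(l), and as building blocks for prescribing derivatives without changing the
  boundary values.\<close>

lemma hermite_cubic:
  assumes l: "0 < l"
  obtains v v' v'' w w' w'' where
    "W22 l v v' v''" "continuous_on {0..l} v''"
    "v 0 = 0" "v l = 0" "v' 0 = 1" "v' l = 0"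
    "\<And>x. x \<in> {0..l} \<Longrightarrow> cmod (v x) \<le> l" "\<And>x. x \<in> {0..l} \<Longrightarrow> cmod (v'' x) \<le> 4 / l"
    "W22 l w w' w''" "continuous_on {0..l} w''"
    "w 0 = 0" "w l = 0" "w' 0 = 0" "w' l = -1"
    "\<And>x. x \<in> {0..l} \<Longrightarrow> cmod (w x) \<le> l" "\<And>x. x \<in> {0..l} \<Longrightarrow> cmod (w'' x) \<le> 4 / l"
proof -
  define c where "c = 1 / l"
  have cl: "c * l = 1" using l by (simp add: c_def)
  note cb = cubic_bound[OF l c_def]
  \<comment> \<open>\<open>v x = x (1 - x/l)\<^sup>2\<close> and \<open>w x = (x\<^sup>2/l) (1 - x/l)\<close>\<close>
  define v where "v = (\<lambda>x. x - 2 * c * x^2 + c^2 * x^3)"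
  define v' where "v' = (\<lambda>x. 1 - 4 * c * x + 3 * c^2 * x^2)"
  define v'' where "v'' = (\<lambda>x. 6 * c^2 * x - 4 * c)"
  define w where "w = (\<lambda>x. c * x^2 - c^2 * x^3)"
  define w' where "w' = (\<lambda>x. 2 * c * x - 3 * c^2 * x^2)"
  define w'' where "w'' = (\<lambda>x. 2 * c - 6 * c^2 * x)"
  have W: "W22 l (\<lambda>x. of_real (v x)) (\<lambda>x. of_real (v' x)) (\<lambda>x. of_real (v'' x))"
    "W22 l (\<lambda>x. of_real (w x)) (\<lambda>x. of_real (w' x)) (\<lambda>x. of_real (w'' x))"
    by (rule W22_of_real; auto simp: v_def v'_def v''_def w_def w'_def w''_def
        intro!: derivative_eq_intros continuous_intros)+
  have C: "continuous_on {0..l} (\<lambda>x. complex_of_real (v'' x))" "continuous_on {0..l} (\<lambda>x. complex_of_real (w'' x))"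
    unfolding v''_def w''_def by (intro continuous_intros)+
  have "v l = l * (1 - 2 * (c * l) + (c * l)^2)" "v' l = 1 - 4 * (c * l) + 3 * (c * l)^2"
    "w l = l * (c * l - (c * l)^2)" "w' l = 2 * (c * l) - 3 * (c * l)^2"
    by (simp_all add: v_def v'_def w_def w'_def algebra_simps power2_eq_square power3_eq_cube)
  then have b: "v l = 0" "v' l = 0" "v 0 = 0" "v' 0 = 1" "w l = 0" "w' l = -1" "w 0 = 0" "w' 0 = 0"
    unfolding cl by (simp_all add: v_def v'_def w_def w'_def)
  show thesis
    by (rule that[OF W(1) C(1) _ _ _ _ _ _ W(2) C(2)])
      (simp_all only: b of_real_0 of_real_1 of_real_minus,
       simp_all only: norm_of_real v_def v''_def w_def w''_def atLeastAtMost_iff cb)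
qed

text \<open>The cubic test functions bound |u(0)| and |u(l)| with the coefficient 4 /
  \<open>sqrt l\<close> in front of the norm of u. Multiplying by \<open>sqrt l\<close>, the weight
  in \<open>Gamma0\<close>, turns this into the constant 4 and leaves only the positive power
  l^2.\<close>

lemma W22_trace_bound:
  assumes l: "0 < l" and u: "W22 l u u' u''"
  shows "sqrt l * cmod (u 0) \<le> l\<^sup>2 * sqrt (nrm2 l u'') + 4 * sqrt (nrm2 l u)"
    and "sqrt l * cmod (u l) \<le> l\<^sup>2 * sqrt (nrm2 l u'') + 4 * sqrt (nrm2 l u)"
proof -
  have ss: "sqrt l * (l * sqrt l * N + 4 / l * sqrt l * M) = l\<^sup>2 * N + 4 * M" for N M
  proof -
    have "sqrt l * (l * sqrt l * N + 4 / l * sqrt l * M) = (sqrt l * sqrt l) * (l * N + 4 / l * M)"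
      by (simp only: ring_distribs mult_ac)
    also have "\<dots> = l\<^sup>2 * N + 4 * M" using l by (simp add: ring_distribs power2_eq_square)
    finally show ?thesis .
  qed
  obtain v v' v'' w w' w'' where
    v: "W22 l v v' v''" "continuous_on {0..l} v''"
      "v 0 = 0" "v l = 0" "v' 0 = 1" "v' l = 0"
      "\<And>x. x \<in> {0..l} \<Longrightarrow> cmod (v x) \<le> l" "\<And>x. x \<in> {0..l} \<Longrightarrow> cmod (v'' x) \<le> 4 / l" and
    w: "W22 l w w' w''" "continuous_on {0..l} w''"
      "w 0 = 0" "w l = 0" "w' 0 = 0" "w' l = -1"
      "\<And>x. x \<in> {0..l} \<Longrightarrow> cmod (w x) \<le> l" "\<And>x. x \<in> {0..l} \<Longrightarrow> cmod (w'' x) \<le> 4 / l"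
    by (rule hermite_cubic[OF l]) blast
  have "cmod (u 0) \<le> l * sqrt l * sqrt (nrm2 l u'') + 4 / l * sqrt l * sqrt (nrm2 l u)"
    using W22_boundary_value_bound[OF l u v(1,2,7,8)] v(3-6) by simp
  from mult_left_mono[OF this, of "sqrt l"]
  show "sqrt l * cmod (u 0) \<le> l\<^sup>2 * sqrt (nrm2 l u'') + 4 * sqrt (nrm2 l u)"
    using l unfolding ss by simp
  have "cmod (u l) \<le> l * sqrt l * sqrt (nrm2 l u'') + 4 / l * sqrt l * sqrt (nrm2 l u)"
    using W22_boundary_value_bound[OF l u w(1,2,7,8)] w(3-6) by simp
  from mult_left_mono[OF this, of "sqrt l"]
  show "sqrt l * cmod (u l) \<le> l\<^sup>2 * sqrt (nrm2 l u'') + 4 * sqrt (nrm2 l u)"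
    using l unfolding ss by simp
qed

text \<open>The test functions l - x and x have zero second derivative, so the norm of
  \<open>u\<close> itself drops out. The resulting factor l^(3/2) is the inverse of the weight in
  \<open>Gamma1\<close>.\<close>

lemma W22_derivative_defect_bound:
  assumes l: "0 < l" and u: "W22 l u u' u''"
  shows "cmod (of_real l * u' 0 + u 0 - u l) \<le> l * sqrt l * sqrt (nrm2 l u'')"
    and "cmod (of_real l * - u' l - u 0 + u l) \<le> l * sqrt l * sqrt (nrm2 l u'')"
proof -
  have b: "cmod (of_real l + (-1) * of_real x) \<le> l" "cmod (0 + 1 * of_real x) \<le> l" if "x \<in> {0..l}" for x
  proof -
    have "of_real l + (-1) * of_real x = (of_real (l - x) :: complex)" by simp
    then show "cmod (of_real l + (-1) * of_real x) \<le> l" using that by (simp only: norm_of_real) auto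
  qed (use that in auto)
  show "cmod (of_real l * u' 0 + u 0 - u l) \<le> l * sqrt l * sqrt (nrm2 l u'')"
    using W22_boundary_value_bound[OF l u W22_affine[of l "of_real l" "-1"] continuous_on_const b(1), of 0]
    by (simp add: norm_minus_commute algebra_simps)
  show "cmod (of_real l * - u' l - u 0 + u l) \<le> l * sqrt l * sqrt (nrm2 l u'')"
    using W22_boundary_value_bound[OF l u W22_affine[of l 0 1] continuous_on_const b(2), of 0]
      norm_minus_cancel[of "of_real l * - u' l - u 0 + u l"]
    by (simp add: algebra_simps del: norm_minus_cancel)
qed

section \<open>Weak solutions, interpolation and eigenfunctions on an edge\<close>

lemma nrm2_le:
  assumes l: "0 < l" and u: "continuous_on {0..l} u" and B: "\<And>x. x \<in> {0..l} \<Longrightarrow> cmod (u x) \<le> B"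
  shows "nrm2 l u \<le> l * B\<^sup>2"
proof -
  have "nrm2 l u \<le> (LINT x:{0..l}|lborel. B\<^sup>2)"
    unfolding nrm2_def
    by (intro set_integral_mono set_integrable_continuous continuous_intros u power_mono B norm_ge_zero)
  then show ?thesis using l by (simp add: set_lebesgue_integral_const_real)
qed

lemma integral_mult_cnj_self: "(LINT x:{0..l}|lborel. u x * cnj (u x)) = of_real (nrm2 l u)"
proof -
  have "(\<lambda>x. u x * cnj (u x)) = (\<lambda>x. of_real ((cmod (u x))\<^sup>2))"
    by (intro ext) (rule complex_norm_square[symmetric, unfolded of_real_power[symmetric]])
  then show ?thesis unfolding nrm2_def by (simp only: set_integral_complex_of_real)
qed

lemma nrm2_eq_0_imp_AE:
  assumes "sq_int l u" "nrm2 l u = 0"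
  shows "AE x in lborel. x \<in> {0..l} \<longrightarrow> u x = 0"
proof -
  have "AE x in lborel. indicator {0..l} x *\<^sub>R (cmod (u x))\<^sup>2 = 0"
    using assms unfolding sq_int_def set_integrable_def nrm2_def set_lebesgue_integral_def
    by (subst integral_nonneg_eq_0_iff_AE[symmetric]) auto
  then show ?thesis by (auto simp: indicator_def)
qed

lemma integral_affine:
  fixes c d :: complex
  assumes "0 \<le> l"
  shows "(LINT x:{0..l}|lborel. c + d * of_real x) = c * of_real l + d * of_real (l\<^sup>2 / 2)"
    and "(LINT x:{0..l}|lborel. (c + d * of_real x) * of_real x) = c * of_real (l\<^sup>2 / 2) + d * of_real (l ^ 3 / 3)"
proof -
  have D1: "((\<lambda>x. c * of_real x + d * ((of_real x)\<^sup>2 / 2)) has_vector_derivative c + d * of_real x)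
      (at x within {0..l})" for x
    by (rule has_vector_derivative_real_field) (auto intro!: derivative_eq_intros)
  have D2: "((\<lambda>x. c * ((of_real x)\<^sup>2 / 2) + d * (of_real x ^ 3 / 3)) has_vector_derivative
      (c + d * of_real x) * of_real x) (at x within {0..l})" for x
    by (rule has_vector_derivative_real_field)
      (auto intro!: derivative_eq_intros simp: algebra_simps power2_eq_square)
  have C: "continuous_on {0..l} (\<lambda>x. c + d * of_real x)"
    "continuous_on {0..l} (\<lambda>x. (c + d * of_real x) * of_real x)"
    by (intro continuous_intros)+
  show "(LINT x:{0..l}|lborel. c + d * of_real x) = c * of_real l + d * of_real (l\<^sup>2 / 2)"
    using integral_FTC_continuous[OF assms D1 C(1)] by simp
  show "(LINT x:{0..l}|lborel. (c + d * of_real x) * of_real x) = c * of_real (l\<^sup>2 / 2) + d * of_real (l ^ 3 / 3)"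
    using integral_FTC_continuous[OF assms D2 C(2)] by simp
qed

text \<open>The Gram matrix of 1 and x on [0,l] has determinant l^4/12, so every pair of moments is
  attained. Eliminating \<open>c\<close> leaves d l^3/12 = X - W l/2, which gives the formula for
  \<open>d\<close>.\<close>

lemma affine_moments:
  fixes W X :: complex
  assumes l: "0 < l"
  obtains c d where "(LINT x:{0..l}|lborel. c + d * of_real x) = W"
    and "(LINT x:{0..l}|lborel. (c + d * of_real x) * of_real x) = X"
proof -
  define L where "L = complex_of_real l"
  have L: "L \<noteq> 0" using l by (simp add: L_def)
  define d where "d = 12 / L^3 * (X - W * L / 2)"
  define c where "c = W / L - d * L / 2"
  have W: "c * L + d * (L\<^sup>2 / 2) = W"
    using L by (simp add: c_def field_simps power2_eq_square)
  have "c * (L\<^sup>2 / 2) + d * (L^3 / 3) = W * L / 2 + d * (L^3 / 12)"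
    using L by (simp add: c_def field_simps power2_eq_square power3_eq_cube)
  moreover have "d * (L^3 / 12) = X - W * L / 2"
    using L by (simp add: d_def)
  ultimately have "c * (L\<^sup>2 / 2) + d * (L^3 / 3) = X" by (metis add.commute diff_add_cancel)
  with W show thesis
    using l by (intro that[of c d]) (simp_all add: integral_affine L_def)
qed

text \<open>In the proof, \<open>k\<close> is the component of \<open>f - F0\<close> orthogonal to \<open>1\<close> and \<open>x\<close>; this makes its second
  primitive vanish to first order at both endpoints, hence a legitimate test function.\<close>

lemma W22_weak_formulation:
  assumes l: "0 < l" and f: "sq_int l f" and h: "sq_int l h"
    and weak: "\<And>g g' g''. W22 l g g' g'' \<Longrightarrow> g 0 = 0 \<Longrightarrow> g l = 0 \<Longrightarrow> g' 0 = 0 \<Longrightarrow> g' l = 0 \<Longrightarrow>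
      - (LINT x:{0..l}|lborel. g'' x * cnj (f x)) = (LINT x:{0..l}|lborel. g x * cnj (h x))"
  obtains F F' where "W22 l F F' (\<lambda>x. - h x)" "AE x in lborel. x \<in> {0..l} \<longrightarrow> F x = f x"
proof -
  have l0: "0 \<le> l" using l by simp
  \<comment> \<open>The initial values of this particular solution may be arbitrary: the affine
    function that corrects them is added at the end.\<close>
  obtain F0 F0' where F0: "W22 l F0 F0' (\<lambda>x. - h x)"
    by (rule W22_initial_value[OF l0 sq_int_uminus[OF h]])
  define w where "w = (\<lambda>x. f x - F0 x)"
  have w: "sq_int l w" unfolding w_def by (intro sq_int_diff f W22_sq_int[OF F0])
  have x: "sq_int l (\<lambda>x. of_real x)"
    by (intro sq_int_continuous continuous_intros)
  obtain c d where cd: "(LINT x:{0..l}|lborel. c + d * of_real x) = (LINT x:{0..l}|lborel. w x)"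
      "(LINT x:{0..l}|lborel. (c + d * of_real x) * of_real x) = (LINT x:{0..l}|lborel. w x * of_real x)"
    by (rule affine_moments[OF l])
  define k where "k = (\<lambda>x. w x - (c + d * of_real x))"
  have a: "sq_int l (\<lambda>x. c + d * of_real x)" by (intro sq_int_continuous continuous_intros)
  have k: "sq_int l k" unfolding k_def by (intro sq_int_diff w a)
  have k1: "(LINT x:{0..l}|lborel. k x) = 0"
    unfolding k_def using cd sq_int_integrable[OF w] sq_int_integrable[OF a] by simp
  have kx: "(LINT x:{0..l}|lborel. k x * of_real x) = 0"
    unfolding k_def left_diff_distrib using cd sq_int_mult_integrable[OF w x] sq_int_mult_integrable[OF a x]
    by simp
  obtain g g' where g: "W22 l g g' k" and g0: "g 0 = 0" "g' 0 = 0"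
    by (rule W22_initial_value[OF l0 k])
  \<comment> \<open>Green's identity against 1 and x turns the two vanishing moments of
    \<open>k\<close> into the two missing boundary conditions at \<open>l\<close>.\<close>
  have g'l: "g' l = 0"
    using W22_Green[OF l0 g W22_affine[of l 1 0]] g0 k1 by simp
  have gl: "g l = 0"
    using W22_Green[OF l0 g W22_affine[of l 0 1]] g0 kx g'l by simp
  have "- (LINT x:{0..l}|lborel. k x * cnj (f x)) = (LINT x:{0..l}|lborel. g x * cnj (h x))"
    by (rule weak[OF g g0(1) gl g0(2) g'l])
  \<comment> \<open>\<open>F0\<close> satisfies the same identity as \<open>f\<close>, so
    subtracting the two eliminates \<open>h\<close> and makes \<open>k\<close> orthogonal to f -
    F0.\<close>
  moreover have "(LINT x:{0..l}|lborel. k x * cnj (F0 x)) - (LINT x:{0..l}|lborel. g x * - cnj (h x)) = 0"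
    using W22_Green[OF l0 g W22_cnj[OF F0]] g0 gl g'l by simp
  moreover have "(LINT x:{0..l}|lborel. g x * - cnj (h x)) = - (LINT x:{0..l}|lborel. g x * cnj (h x))"
    using set_integral_uminus[OF sq_int_mult_integrable[OF W22_sq_int[OF g] sq_int_cnj[OF h]]] by simp
  ultimately have "(LINT x:{0..l}|lborel. k x * cnj (f x)) - (LINT x:{0..l}|lborel. k x * cnj (F0 x)) = 0"
    by (simp add: add_eq_0_iff)
  then have "(LINT x:{0..l}|lborel. k x * cnj (f x) - k x * cnj (F0 x)) = 0"
    using sq_int_mult_integrable[OF k sq_int_cnj[OF f]]
      sq_int_mult_integrable[OF k sq_int_cnj[OF W22_sq_int[OF F0]]] by simp
  then have kw: "(LINT x:{0..l}|lborel. k x * cnj (w x)) = 0"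
    by (simp add: w_def algebra_simps)
  have "(LINT x:{0..l}|lborel. k x * cnj (c + d * of_real x))
      = (LINT x:{0..l}|lborel. cnj c * k x + cnj d * (k x * of_real x))"
    by (simp add: algebra_simps)
  also have "\<dots> = 0"
    using sq_int_integrable[OF k] sq_int_mult_integrable[OF k x] k1 kx by simp
  finally have ka: "(LINT x:{0..l}|lborel. k x * cnj (c + d * of_real x)) = 0" .
  \<comment> \<open>\<open>k\<close> is \<open>w\<close> minus an affine function and is orthogonal
    to both, hence to itself.\<close>
  have "(LINT x:{0..l}|lborel. k x * cnj (k x))
      = (LINT x:{0..l}|lborel. k x * cnj (w x) - k x * cnj (c + d * of_real x))"
    by (intro set_lebesgue_integral_cong) (auto simp: k_def algebra_simps)
  also have "\<dots> = 0"
    using sq_int_mult_integrable[OF k sq_int_cnj[OF w]] sq_int_mult_integrable[OF k sq_int_cnj[OF a]]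
    by (simp only: set_integral_diff kw ka diff_self)
  finally have "nrm2 l k = 0" unfolding integral_mult_cnj_self by simp
  from nrm2_eq_0_imp_AE[OF k this]
  have "AE x in lborel. x \<in> {0..l} \<longrightarrow> F0 x + (c + d * of_real x) = f x"
    by (rule AE_mp) (intro AE_I2, auto simp: k_def w_def algebra_simps)
  moreover have "W22 l (\<lambda>x. F0 x + (c + d * of_real x)) (\<lambda>x. F0' x + d) (\<lambda>x. - h x)"
    using W22_add[OF F0 W22_affine[of l c d]] by simp
  ultimately show thesis by (intro that)
qed

text \<open>An affine interpolant of \<open>a\<close> and \<open>b\<close> has both defects zero,
  and the two cubics vanish at the endpoints, so boundary values and defects can be prescribed
  independently. Only the cubics have a second derivative, which is why \<open>a\<close> and
  \<open>b\<close> are absent from the last bound.\<close>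

lemma W22_hermite_interpolation:
  assumes l: "0 < l"
  obtains u u' u'' where "W22 l u u' u''" "u 0 = a" "u l = b"
    "of_real l * u' 0 + a - b = P" "of_real l * - u' l - a + b = Q"
    "nrm2 l u \<le> l * (cmod a + cmod b + cmod P + cmod Q)\<^sup>2"
    "nrm2 l u'' \<le> 16 / l ^ 3 * (cmod P + cmod Q)\<^sup>2"
proof -
  define L where "L = complex_of_real l"
  have L: "L \<noteq> 0" "cmod L = l" using l by (auto simp: L_def)
  obtain v v' v'' w w' w'' where
    v: "W22 l v v' v''" "continuous_on {0..l} v''"
      "v 0 = 0" "v l = 0" "v' 0 = 1" "v' l = 0"
      "\<And>x. x \<in> {0..l} \<Longrightarrow> cmod (v x) \<le> l" "\<And>x. x \<in> {0..l} \<Longrightarrow> cmod (v'' x) \<le> 4 / l" and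
    w: "W22 l w w' w''" "continuous_on {0..l} w''"
      "w 0 = 0" "w l = 0" "w' 0 = 0" "w' l = -1"
      "\<And>x. x \<in> {0..l} \<Longrightarrow> cmod (w x) \<le> l" "\<And>x. x \<in> {0..l} \<Longrightarrow> cmod (w'' x) \<le> 4 / l"
    by (rule hermite_cubic[OF l]) blast
  define u where "u = (\<lambda>x. a + (b - a) / L * of_real x + (P / L * v x + Q / L * w x))"
  define u' where "u' = (\<lambda>x. (b - a) / L + (P / L * v' x + Q / L * w' x))"
  define u'' where "u'' = (\<lambda>x. 0 + (P / L * v'' x + Q / L * w'' x))"
  have u: "W22 l u u' u''"
    unfolding u_def u'_def u''_def by (intro W22_add W22_affine W22_cmult v(1) w(1))
  have bd: "cmod (u x) \<le> cmod a + cmod b + cmod P + cmod Q"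
    "cmod (u'' x) \<le> 4 / l\<^sup>2 * (cmod P + cmod Q)" if x: "x \<in> {0..l}" for x
  proof -
    define t where "t = x / l"
    have t: "0 \<le> t" "t \<le> 1" using x l by (auto simp: t_def)
    \<comment> \<open>The affine part is a convex combination of \<open>a\<close> and
      \<open>b\<close>, so its bound is free of \<open>l\<close>.\<close>
    have "a + (b - a) / L * of_real x = of_real (1 - t) * a + of_real t * b"
      using L by (simp add: t_def L_def field_simps)
    also have "cmod \<dots> \<le> (1 - t) * cmod a + t * cmod b"
      using t by (intro order_trans[OF norm_triangle_ineq]) (simp add: norm_mult del: of_real_diff)
    also have "\<dots> \<le> cmod a + cmod b"
      using t by (intro add_mono mult_left_le_one_le) auto
    finally have 1: "cmod (a + (b - a) / L * of_real x) \<le> cmod a + cmod b" .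
    have m: "cmod (r / L * y) \<le> cmod r / l * B" if "cmod y \<le> B" for r y B
      unfolding norm_mult norm_divide L by (rule mult_left_mono[OF that]) (use l in auto)
    have "cmod (P / L * v x) \<le> cmod P" "cmod (Q / L * w x) \<le> cmod Q"
      using m[OF v(7)[OF x], of P] m[OF w(7)[OF x], of Q] l by simp_all
    then have "cmod (P / L * v x + Q / L * w x) \<le> cmod P + cmod Q"
      by (intro order_trans[OF norm_triangle_ineq] add_mono)
    with 1 have "cmod (u x) \<le> (cmod a + cmod b) + (cmod P + cmod Q)"
      unfolding u_def by (rule order_trans[OF norm_triangle_ineq add_mono])
    then show "cmod (u x) \<le> cmod a + cmod b + cmod P + cmod Q" by simp
    have "cmod (P / L * v'' x) \<le> cmod P / l * (4 / l)" "cmod (Q / L * w'' x) \<le> cmod Q / l * (4 / l)"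
      by (intro m v(8)[OF x] w(8)[OF x])+
    then have "cmod (u'' x) \<le> cmod P / l * (4 / l) + cmod Q / l * (4 / l)"
      unfolding u''_def add_0 by (intro order_trans[OF norm_triangle_ineq] add_mono)
    also have "\<dots> = 4 / l\<^sup>2 * (cmod P + cmod Q)" using l by (simp add: field_simps power2_eq_square)
    finally show "cmod (u'' x) \<le> 4 / l\<^sup>2 * (cmod P + cmod Q)" .
  qed
  have "nrm2 l u'' \<le> l * (4 / l\<^sup>2 * (cmod P + cmod Q))\<^sup>2"
  proof (rule nrm2_le[OF l])
    show "continuous_on {0..l} u''" unfolding u''_def by (intro continuous_intros v(2) w(2))
  qed (rule bd)
  also have "\<dots> = 16 / l ^ 3 * (cmod P + cmod Q)\<^sup>2"
    using l by (simp add: power_mult_distrib power_divide field_simps power2_eq_square power3_eq_cube)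
  finally have n2: "nrm2 l u'' \<le> 16 / l ^ 3 * (cmod P + cmod Q)\<^sup>2" .
  have n1: "nrm2 l u \<le> l * (cmod a + cmod b + cmod P + cmod Q)\<^sup>2"
    by (rule nrm2_le[OF l W22_continuous[OF u] bd(1)])
  show thesis
    by (rule that[OF u _ _ _ _ n1 n2])
      (use L in \<open>simp_all add: u_def u'_def v w field_simps flip: L_def\<close>)
qed

section \<open>Eigenfunctions for a non-real spectral parameter\<close>

lemma cmod_sin_squared: "(cmod (sin z))\<^sup>2 = (sin (Re z))\<^sup>2 + (sinh (Im z))\<^sup>2"
proof -
  have "exp (2 * Im z) + inverse (exp (2 * Im z)) = 2 * cosh (2 * Im z)"
    by (simp add: cosh_field_def exp_minus)
  then show ?thesis
    unfolding norm_sin_squared by (simp add: cosh_double_cosh cos_double_sin cosh_square_eq)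
qed

lemma le_sinh_real: "0 \<le> (x::real) \<Longrightarrow> x \<le> sinh x"
  using real_le_x_sinh[of x] by (simp add: sinh_field_def exp_minus)

text \<open>Since \<open>|sin (a + ib)|\<^sup>2 = sin\<^sup>2 a + sinh\<^sup>2 b\<close> and \<open>|sin a| \<le> |a|\<close>, \<open>sinh |b| \<ge> |b|\<close>,
  the constant does not depend on \<open>l\<close>, so no lower bound on the edge lengths is needed.\<close>

lemma sin_ratio_bound:
  assumes s: "Im s \<noteq> 0" and x: "0 \<le> x" "x \<le> l"
  shows "cmod (sin (of_real x * s)) \<le> sqrt ((Re s / Im s)\<^sup>2 + 1) * cmod (sin (of_real l * s))"
proof -
  define a b where "a = \<bar>Re s\<bar>" and "b = \<bar>Im s\<bar>"
  have b: "b > 0" using s by (simp add: b_def)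
  have "\<bar>sin (x * Re s)\<bar> \<le> l * a"
    using abs_sin_x_le_abs_x[of "x * Re s"] mult_right_mono[OF x(2), of a] x
    by (simp add: a_def abs_mult)
  then have 1: "(sin (x * Re s))\<^sup>2 \<le> (l * a)\<^sup>2" by (metis abs_le_square_iff abs_of_nonneg abs_ge_zero order_trans)
  have "\<bar>sinh (x * Im s)\<bar> \<le> sinh (l * b)"
    using mult_right_mono[OF x(2), of b] x by (simp add: b_def abs_mult flip: sinh_real_abs)
  then have 2: "(sinh (x * Im s))\<^sup>2 \<le> (sinh (l * b))\<^sup>2" by (metis abs_le_square_iff abs_of_nonneg abs_ge_zero order_trans)
  have "l * b \<le> sinh (l * b)" using x b by (intro le_sinh_real) auto
  then have 3: "(l * b)\<^sup>2 \<le> (sinh (l * b))\<^sup>2" using x b by (intro power_mono) auto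
  have 4: "(sinh (l * b))\<^sup>2 = (sinh (l * Im s))\<^sup>2"
  proof -
    have "l * b = \<bar>l * Im s\<bar>" using x by (simp add: b_def abs_mult)
    then show ?thesis by (simp only: sinh_real_abs power2_abs)
  qed
  \<comment> \<open>Here the ratio of real to imaginary part enters: the linear bound l a on the
    sine is traded for l b, which \<open>sinh\<close> dominates.\<close>
  have "(l * a)\<^sup>2 = (a / b)\<^sup>2 * (l * b)\<^sup>2" using b by (simp add: power_mult_distrib power_divide)
  also have "\<dots> \<le> (a / b)\<^sup>2 * (sinh (l * b))\<^sup>2" by (intro mult_left_mono 3) auto
  finally have "(sin (x * Re s))\<^sup>2 + (sinh (x * Im s))\<^sup>2 \<le> ((a / b)\<^sup>2 + 1) * (sinh (l * b))\<^sup>2"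
    using 1 2 by (simp add: distrib_right)
  also have "\<dots> \<le> ((a / b)\<^sup>2 + 1) * ((sin (l * Re s))\<^sup>2 + (sinh (l * Im s))\<^sup>2)"
    unfolding 4 by (intro mult_left_mono) auto
  also have "(a / b)\<^sup>2 = (Re s / Im s)\<^sup>2" by (simp add: a_def b_def power_divide)
  finally have "(cmod (sin (of_real x * s)))\<^sup>2 \<le> ((Re s / Im s)\<^sup>2 + 1) * (cmod (sin (of_real l * s)))\<^sup>2"
    unfolding cmod_sin_squared by simp
  from real_le_rsqrt[OF this] show ?thesis by (simp add: real_sqrt_mult)
qed

lemma sin_nonzero_nonreal:
  assumes "Im s \<noteq> 0" "0 < l"
  shows "sin (of_real l * s) \<noteq> 0"
proof
  assume "sin (of_real l * s) = 0"
  then have "(sin (l * Re s))\<^sup>2 + (sinh (l * Im s))\<^sup>2 = 0"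
    using cmod_sin_squared[of "of_real l * s"] by simp
  then show False using assms by (simp add: sum_power2_eq_zero_iff)
qed

lemma Im_csqrt_nonzero:
  assumes "Im z \<noteq> 0"
  shows "Im (csqrt z) \<noteq> 0"
proof
  assume "Im (csqrt z) = 0"
  then have "Im (csqrt z * csqrt z) = 0" by (simp only: times_complex.sel mult_zero_left mult_zero_right add_0)
  moreover have "csqrt z * csqrt z = z" using power2_csqrt[of z] by (simp only: power2_eq_square)
  ultimately show False using assms by simp
qed

text \<open>One computation serves both solutions: p = 0, q = 1 gives the sine vanishing at 0, and p
  = l, q = -1 the one vanishing at l.\<close>

lemma W22_sin_affine:
  "W22 l (\<lambda>x. sin (s * (of_real p + of_real q * of_real x)))
    (\<lambda>x. of_real q * s * cos (s * (of_real p + of_real q * of_real x)))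
    (\<lambda>x. - (of_real q * s)\<^sup>2 * sin (s * (of_real p + of_real q * of_real x)))"
proof (rule W22_C2)
  fix x
  have "((\<lambda>x. sin (s * (of_real p + of_real q * x))) has_field_derivative
      of_real q * s * cos (s * (of_real p + of_real q * of_real x))) (at (of_real x))"
    by (auto intro!: derivative_eq_intros)
  then show "((\<lambda>x. sin (s * (of_real p + of_real q * of_real x))) has_vector_derivative
      of_real q * s * cos (s * (of_real p + of_real q * of_real x))) (at x within {0..l})"
    by (rule has_vector_derivative_real_field)
  have "((\<lambda>x. of_real q * s * cos (s * (of_real p + of_real q * x))) has_field_derivative
      - (of_real q * s)\<^sup>2 * sin (s * (of_real p + of_real q * of_real x))) (at (of_real x))"
    by (auto intro!: derivative_eq_intros simp: power2_eq_square)
  then show "((\<lambda>x. of_real q * s * cos (s * (of_real p + of_real q * of_real x))) has_vector_derivative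
      - (of_real q * s)\<^sup>2 * sin (s * (of_real p + of_real q * of_real x))) (at x within {0..l})"
    by (rule has_vector_derivative_real_field)
qed (intro continuous_intros)

lemma W22_sin:
  fixes z :: complex
  defines "s \<equiv> csqrt z"
  shows "W22 l (\<lambda>x. sin (s * of_real x)) (\<lambda>x. s * cos (s * of_real x)) (\<lambda>x. - (z * sin (s * of_real x)))"
    and "W22 l (\<lambda>x. sin (s * of_real (l - x))) (\<lambda>x. - (s * cos (s * of_real (l - x))))
      (\<lambda>x. - (z * sin (s * of_real (l - x))))"
  using W22_sin_affine[of l s 0 1] W22_sin_affine[of l s l "-1"] by (simp_all add: s_def)

text \<open>Testing with a solution for the same z makes the two integrals cancel. The sine that
  vanishes at l removes u'(l) from the boundary terms and leaves an equation for u'(0); the other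
  sine does the opposite. No explicit form of \<open>u\<close> is used.\<close>

lemma eigenfunction_derivatives:
  fixes z :: complex
  defines "s \<equiv> csqrt z"
  assumes l: "0 < l" and u: "W22 l u u' (\<lambda>x. - (z * u x))"
  shows "u' 0 * sin (of_real l * s) = s * u l - s * cos (of_real l * s) * u 0"
    and "- u' l * sin (of_real l * s) = s * u 0 - s * cos (of_real l * s) * u l"
proof -
  have l0: "0 \<le> l" using l by simp
  have W: "u' l * v l - u' 0 * v 0 - u l * v' l + u 0 * v' 0 = 0"
    if "W22 l v v' (\<lambda>x. - (z * v x))" for v v'
    using W22_Green[OF l0 u that] by (simp add: mult_ac)
  show "u' 0 * sin (of_real l * s) = s * u l - s * cos (of_real l * s) * u 0"
    using W[OF W22_sin(2)] by (simp add: s_def algebra_simps)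
  show "- u' l * sin (of_real l * s) = s * u 0 - s * cos (of_real l * s) * u l"
    using W[OF W22_sin(1)] by (simp add: s_def algebra_simps)
qed

text \<open>The symmetry argument for real Dirichlet eigenvalues: Green's identity with the
  conjugate of \<open>u\<close> gives (cnj z - z) times the squared norm equal to zero.\<close>

lemma eigenfunction_unique:
  assumes l: "0 < l" and z: "Im z \<noteq> 0" and u: "W22 l u u' (\<lambda>x. - (z * u x))" and b: "u 0 = 0" "u l = 0"
  shows "AE x in lborel. x \<in> {0..l} \<longrightarrow> u x = 0"
proof -
  have l0: "0 \<le> l" using l by simp
  have i: "set_integrable lborel {0..l} (\<lambda>x. u x * cnj (u x))"
    by (intro sq_int_mult_integrable sq_int_cnj W22_sq_int[OF u])
  have e: "(\<lambda>x. - (z * u x) * cnj (u x)) = (\<lambda>x. (- z) * (u x * cnj (u x)))"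
    "(\<lambda>x. u x * cnj (- (z * u x))) = (\<lambda>x. (- cnj z) * (u x * cnj (u x)))"
    by auto
  have "(LINT x:{0..l}|lborel. - (z * u x) * cnj (u x)) - (LINT x:{0..l}|lborel. u x * cnj (- (z * u x))) = 0"
    using W22_Green[OF l0 u W22_cnj[OF u]] b by simp
  then have "- z * of_real (nrm2 l u) - (- cnj z * of_real (nrm2 l u)) = 0"
    unfolding e set_integral_mult_right integral_mult_cnj_self .
  then have "(cnj z - z) * of_real (nrm2 l u) = 0" by (simp add: algebra_simps)
  moreover have "cnj z - z \<noteq> 0" using z by (auto simp: complex_eq_iff)
  ultimately have "nrm2 l u = 0" by simp
  then show ?thesis by (rule nrm2_eq_0_imp_AE[OF W22_sq_int[OF u]])
qed

text \<open>The Dirichlet problem is solved by the two sines divided by sin(l \<open>s\<close>).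
  This quotient could degenerate on short edges; \<open>sin_ratio_bound\<close> keeps it bounded in
  terms of z only.\<close>

lemma eigenfunction_exists:
  fixes z :: complex
  defines "s \<equiv> csqrt z"
  assumes l: "0 < l" and z: "Im z \<noteq> 0"
  obtains u u' where "W22 l u u' (\<lambda>x. - (z * u x))" "u 0 = a" "u l = b"
    "nrm2 l u \<le> l * (((Re s / Im s)\<^sup>2 + 1) * (cmod a + cmod b)\<^sup>2)"
proof -
  have s: "Im s \<noteq> 0" unfolding s_def by (rule Im_csqrt_nonzero[OF z])
  define S where "S = sin (of_real l * s)"
  have S: "S \<noteq> 0" unfolding S_def by (rule sin_nonzero_nonreal[OF s l])
  define K where "K = sqrt ((Re s / Im s)\<^sup>2 + 1)"
  define u where "u = (\<lambda>x. a / S * sin (s * of_real (l - x)) + b / S * sin (s * of_real x))"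
  define u' where "u' = (\<lambda>x. a / S * - (s * cos (s * of_real (l - x))) + b / S * (s * cos (s * of_real x)))"
  have "W22 l u u' (\<lambda>x. a / S * - (z * sin (s * of_real (l - x))) + b / S * - (z * sin (s * of_real x)))"
    unfolding u_def u'_def s_def by (intro W22_add W22_cmult W22_sin)
  also have "(\<lambda>x. a / S * - (z * sin (s * of_real (l - x))) + b / S * - (z * sin (s * of_real x))) =
      (\<lambda>x. - (z * u x))" by (simp add: u_def algebra_simps)
  finally have u: "W22 l u u' (\<lambda>x. - (z * u x))" .
  have "cmod (u x) \<le> K * (cmod a + cmod b)" if x: "x \<in> {0..l}" for x
  proof -
    have r: "cmod (c / S * sin (s * of_real y)) \<le> K * cmod c" if "y \<in> {0..l}" for c y
    proof -
      have "cmod (sin (s * of_real y)) \<le> K * cmod S"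
        using sin_ratio_bound[OF s, of y l] that by (simp add: K_def S_def mult.commute)
      then have "cmod c / cmod S * cmod (sin (s * of_real y)) \<le> cmod c / cmod S * (K * cmod S)"
        by (intro mult_left_mono) auto
      then show ?thesis using S by (simp add: norm_mult norm_divide mult.commute)
    qed
    have "cmod (u x) \<le> K * cmod a + K * cmod b"
      unfolding u_def using r[of "l - x" a] r[of x b] x
      by (intro order_trans[OF norm_triangle_ineq]) (auto intro: add_mono)
    then show ?thesis by (simp add: distrib_left)
  qed
  from nrm2_le[OF l W22_continuous[OF u] this]
  have n: "nrm2 l u \<le> l * (((Re s / Im s)\<^sup>2 + 1) * (cmod a + cmod b)\<^sup>2)"
    by (simp add: K_def power_mult_distrib)
  show thesis
    by (rule that[OF u _ _ n]) (use S in \<open>simp_all add: u_def S_def mult.commute\<close>)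
qed

section \<open>Summation over the edges\<close>

lemma L2G_iff: "L2G E len f \<longleftrightarrow> (\<forall>e\<in>E. sq_int (len e) (f e)) \<and> (\<lambda>e. nrm2 (len e) (f e)) summable_on E"
  by (simp add: L2G_def nrm2_def)

lemma nrm2_cmult: "nrm2 l (\<lambda>x. c * u x) = (cmod c)\<^sup>2 * nrm2 l u"
  by (simp add: nrm2_def norm_mult power_mult_distrib)

lemma nrm2_uminus: "nrm2 l (\<lambda>x. - u x) = nrm2 l u"
  by (simp add: nrm2_def)

lemma nrm2_zero: "nrm2 l (\<lambda>x. 0) = 0"
  by (simp add: nrm2_def)

lemma nrm2_cong_AE:
  assumes "sq_int l u" "sq_int l v" "AE x in lborel. x \<in> {0..l} \<longrightarrow> u x = v x"
  shows "nrm2 l u = nrm2 l v"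
  unfolding nrm2_def set_lebesgue_integral_def
proof (rule integral_cong_AE)
  show "AE x in lborel. indicator {0..l} x *\<^sub>R (cmod (u x))\<^sup>2 = indicator {0..l} x *\<^sub>R (cmod (v x))\<^sup>2"
    using assms(3) by (rule AE_mp) (intro AE_I2, auto simp: indicator_def)
qed (use assms in \<open>auto simp: sq_int_def set_integrable_def\<close>)

lemma integral_mult_cong_AE:
  assumes "sq_int l k" "sq_int l u" "sq_int l v" "AE x in lborel. x \<in> {0..l} \<longrightarrow> u x = v x"
  shows "(LINT x:{0..l}|lborel. k x * cnj (u x)) = (LINT x:{0..l}|lborel. k x * cnj (v x))"
  unfolding set_lebesgue_integral_def
proof (rule integral_cong_AE)
  show "AE x in lborel. indicator {0..l} x *\<^sub>R (k x * cnj (u x)) = indicator {0..l} x *\<^sub>R (k x * cnj (v x))"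
    using assms(4) by (rule AE_mp) (intro AE_I2, auto simp: indicator_def)
qed (use sq_int_mult_integrable[OF assms(1) sq_int_cnj[OF assms(2)]]
      sq_int_mult_integrable[OF assms(1) sq_int_cnj[OF assms(3)]] in \<open>auto simp: set_integrable_def\<close>)

text \<open>A crude bound in place of Cauchy-Schwarz: its purpose is a summable majorant for the
  edge terms of \<open>ipG\<close>.\<close>

lemma norm_integral_mult_le:
  assumes u: "sq_int l u" and v: "sq_int l v"
  shows "cmod (LINT x:{0..l}|lborel. u x * cnj (v x)) \<le> nrm2 l u + nrm2 l v"
proof -
  have i: "set_integrable lborel {0..l} (\<lambda>x. u x * cnj (v x))"
    by (intro sq_int_mult_integrable sq_int_cnj u v)
  have iu: "set_integrable lborel {0..l} (\<lambda>x. (cmod (u x))\<^sup>2)"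
    and iv: "set_integrable lborel {0..l} (\<lambda>x. (cmod (v x))\<^sup>2)" using u v by (auto simp: sq_int_def)
  have "cmod (LINT x:{0..l}|lborel. u x * cnj (v x)) \<le> (LINT x:{0..l}|lborel. cmod (u x * cnj (v x)))"
    by (rule set_integral_norm_bound[OF i])
  also have "\<dots> \<le> (LINT x:{0..l}|lborel. (cmod (u x))\<^sup>2 + (cmod (v x))\<^sup>2)"
  proof (rule set_integral_mono[OF set_integrable_norm[OF i]])
    show "set_integrable lborel {0..l} (\<lambda>x. (cmod (u x))\<^sup>2 + (cmod (v x))\<^sup>2)"
      using iu iv by simp
    show "cmod (u x * cnj (v x)) \<le> (cmod (u x))\<^sup>2 + (cmod (v x))\<^sup>2" for x
      using norm_mult_le_sum_squares[of "u x" "cnj (v x)"] by simp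
  qed
  also have "\<dots> = nrm2 l u + nrm2 l v" using iu iv by (simp add: nrm2_def)
  finally show ?thesis .
qed

lemma ipG_summable:
  assumes "L2G E len f" "L2G E len g"
  shows "(\<lambda>e. LINT x:{0..len e}|lborel. f e x * cnj (g e x)) summable_on E"
proof (rule Infinite_Sum.abs_summable_summable, rule Infinite_Sum.abs_summable_on_comparison_test')
  show "(\<lambda>e. nrm2 (len e) (f e) + nrm2 (len e) (g e)) summable_on E"
    using assms by (intro summable_on_add) (simp_all add: L2G_iff)
qed (use assms in \<open>auto simp: L2G_iff intro!: norm_integral_mult_le\<close>)

lemma ipBS_summable:
  assumes "inBS E \<phi>" "inBS E \<psi>"
  shows "(\<lambda>e. fst (\<phi> e) * cnj (fst (\<psi> e)) + snd (\<phi> e) * cnj (snd (\<psi> e))) summable_on E"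
proof (rule Infinite_Sum.abs_summable_summable, rule Infinite_Sum.abs_summable_on_comparison_test')
  show "(\<lambda>e. ((cmod (fst (\<phi> e)))\<^sup>2 + (cmod (snd (\<phi> e)))\<^sup>2) + ((cmod (fst (\<psi> e)))\<^sup>2 + (cmod (snd (\<psi> e)))\<^sup>2)) summable_on E"
    using assms unfolding inBS_def by (rule summable_on_add)
  show "cmod (fst (\<phi> e) * cnj (fst (\<psi> e)) + snd (\<phi> e) * cnj (snd (\<psi> e))) \<le>
    ((cmod (fst (\<phi> e)))\<^sup>2 + (cmod (snd (\<phi> e)))\<^sup>2) + ((cmod (fst (\<psi> e)))\<^sup>2 + (cmod (snd (\<psi> e)))\<^sup>2)" for e
    using norm_mult_le_sum_squares[of "fst (\<phi> e)" "cnj (fst (\<psi> e))"]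
      norm_mult_le_sum_squares[of "snd (\<phi> e)" "cnj (snd (\<psi> e))"]
    by (intro order_trans[OF norm_triangle_ineq]) simp
qed

section \<open>The boundary maps and Green's identity on the graph\<close>

lemma powr_minus_three_halves:
  assumes "0 < (l::real)"
  shows "l powr (-3/2) = 1 / (l * sqrt l)"
proof -
  have "l powr (3/2) = l powr (1 + 1/2)" by simp
  also have "\<dots> = l * sqrt l" using assms by (simp only: powr_add powr_half_sqrt powr_one less_imp_le)
  finally show ?thesis using powr_minus_divide[of l "3/2"] by simp
qed

text \<open>Trading \<open>dv\<close> for a witness \<open>u'\<close> and the real power for a
  square root makes the later identities rational in \<open>sqrt (len e)\<close>.\<close>

lemma Gamma1_W22:
  assumes "0 < len e" "W22 (len e) (f e) u' u''"
  shows "Gamma1 len f e =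
    (of_real (1 / (len e * sqrt (len e))) * (of_real (len e) * u' 0 + f e 0 - f e (len e)),
     of_real (1 / (len e * sqrt (len e))) * (of_real (len e) * - u' (len e) - f e 0 + f e (len e)))"
  using assms W22_dv[OF assms, of 0] W22_dv[OF assms, of "len e"] powr_minus_three_halves[of "len e"]
  by (simp add: Gamma1_def Let_def)

lemma HmaxE:
  assumes "Hmax E len f h" "e \<in> E"
  obtains u' where "W22 (len e) (f e) u' (\<lambda>x. - h e x)"
  using assms by (auto simp: Hmax_def)

text \<open>Squaring the trace bound with (x + y)^2 <= 2 x^2 + 2 y^2 gives 2 M^4 and 2 * 4^2 = 32,
  doubled for the two endpoints. For \<open>Gamma1\<close> the weight cancels the factor of the
  defect bound exactly, so each component costs one norm of \<open>h\<close>.\<close>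

lemma Gamma_bounds:
  assumes l: "0 < len e" "len e \<le> M" and u: "W22 (len e) (f e) u' (\<lambda>x. - h e x)"
  shows "(cmod (fst (Gamma0 len f e)))\<^sup>2 + (cmod (snd (Gamma0 len f e)))\<^sup>2
      \<le> 4 * M ^ 4 * nrm2 (len e) (h e) + 64 * nrm2 (len e) (f e)"
    and "(cmod (fst (Gamma1 len f e)))\<^sup>2 + (cmod (snd (Gamma1 len f e)))\<^sup>2 \<le> 2 * nrm2 (len e) (h e)"
proof -
  define l where "l = len e"
  define N N'' where "N = nrm2 l (f e)" and "N'' = nrm2 l (h e)"
  have N: "0 \<le> N" "0 \<le> N''" by (auto simp: N_def N''_def nrm2_nonneg)
  have l': "0 < l" "l \<le> M" using l by (auto simp: l_def)
  note u' = u[folded l_def]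
  have *: "y\<^sup>2 \<le> 2 * M ^ 4 * N'' + 32 * N" if "0 \<le> y" "y \<le> l\<^sup>2 * sqrt N'' + 4 * sqrt N" for y
  proof -
    have "y\<^sup>2 \<le> (l\<^sup>2 * sqrt N'' + 4 * sqrt N)\<^sup>2" using that by (intro power_mono)
    also have "\<dots> \<le> 2 * (l\<^sup>2 * sqrt N'')\<^sup>2 + 2 * (4 * sqrt N)\<^sup>2"
      using sum_squares_bound[of "l\<^sup>2 * sqrt N''" "4 * sqrt N"] by (simp add: power2_sum)
    also have "\<dots> = 2 * l ^ 4 * N'' + 32 * N"
      using N by (simp add: power_mult_distrib flip: power_mult)
    also have "\<dots> \<le> 2 * M ^ 4 * N'' + 32 * N"
      using l' N by (intro add_mono mult_right_mono mult_left_mono power_mono) auto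
    finally show ?thesis .
  qed
  note t = W22_trace_bound[OF l'(1) u', unfolded nrm2_uminus, folded N_def N''_def]
  have "cmod (fst (Gamma0 len f e)) = sqrt l * cmod (f e 0)" "cmod (snd (Gamma0 len f e)) = sqrt l * cmod (f e l)"
    using l' by (simp_all add: Gamma0_def norm_mult flip: l_def)
  then have "(cmod (fst (Gamma0 len f e)))\<^sup>2 \<le> 2 * M ^ 4 * N'' + 32 * N"
    "(cmod (snd (Gamma0 len f e)))\<^sup>2 \<le> 2 * M ^ 4 * N'' + 32 * N"
    using t l' by (auto intro!: * mult_nonneg_nonneg)
  then show "(cmod (fst (Gamma0 len f e)))\<^sup>2 + (cmod (snd (Gamma0 len f e)))\<^sup>2
      \<le> 4 * M ^ 4 * nrm2 (len e) (h e) + 64 * nrm2 (len e) (f e)"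
    unfolding l_def[symmetric] N_def[symmetric] N''_def[symmetric] by simp
  note d = W22_derivative_defect_bound[OF l'(1) u', unfolded nrm2_uminus, folded N''_def]
  have **: "(cmod (of_real (1 / (l * sqrt l)) * y))\<^sup>2 \<le> N''" if "cmod y \<le> l * sqrt l * sqrt N''" for y
  proof -
    have "cmod (of_real (1 / (l * sqrt l)) * y) = cmod y / (l * sqrt l)"
      using l' by (simp add: norm_mult norm_divide)
    also have "\<dots> \<le> sqrt N''" using that l' by (simp add: divide_le_eq mult_ac)
    finally have "(cmod (of_real (1 / (l * sqrt l)) * y))\<^sup>2 \<le> (sqrt N'')\<^sup>2" by (intro power_mono) auto
    then show ?thesis using N by simp
  qed
  show "(cmod (fst (Gamma1 len f e)))\<^sup>2 + (cmod (snd (Gamma1 len f e)))\<^sup>2 \<le> 2 * nrm2 (len e) (h e)"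
    unfolding Gamma1_W22[of len e f, OF l(1) u] l_def[symmetric] N''_def[symmetric] fst_conv snd_conv
    using **[OF d(1)] **[OF d(2)] by linarith
qed

lemma Gamma_inBS:
  assumes pos: "\<forall>e\<in>E. len e > 0" and bdd: "\<And>e. e \<in> E \<Longrightarrow> len e \<le> M" and f: "Hmax E len f h"
  shows "inBS E (Gamma0 len f)" "inBS E (Gamma1 len f)"
proof -
  have s: "(\<lambda>e. nrm2 (len e) (f e)) summable_on E" "(\<lambda>e. nrm2 (len e) (h e)) summable_on E"
    using f by (auto simp: Hmax_def L2G_iff)
  show "inBS E (Gamma0 len f)" unfolding inBS_def
  proof (rule summable_on_comparison_test)
    show "(\<lambda>e. 4 * M ^ 4 * nrm2 (len e) (h e) + 64 * nrm2 (len e) (f e)) summable_on E"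
      by (intro summable_on_add summable_on_cmult_right s)
    fix e assume e: "e \<in> E"
    then obtain u' where "W22 (len e) (f e) u' (\<lambda>x. - h e x)" by (rule HmaxE[OF f])
    then show "(cmod (fst (Gamma0 len f e)))\<^sup>2 + (cmod (snd (Gamma0 len f e)))\<^sup>2
      \<le> 4 * M ^ 4 * nrm2 (len e) (h e) + 64 * nrm2 (len e) (f e)"
      using pos e by (intro Gamma_bounds(1) bdd) auto
  qed simp
  show "inBS E (Gamma1 len f)" unfolding inBS_def
  proof (rule summable_on_comparison_test)
    show "(\<lambda>e. 2 * nrm2 (len e) (h e)) summable_on E"
      by (intro summable_on_cmult_right s)
    fix e assume e: "e \<in> E"
    then obtain u' where "W22 (len e) (f e) u' (\<lambda>x. - h e x)" by (rule HmaxE[OF f])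
    then show "(cmod (fst (Gamma1 len f e)))\<^sup>2 + (cmod (snd (Gamma1 len f e)))\<^sup>2
      \<le> 2 * nrm2 (len e) (h e)"
      using pos e by (intro Gamma_bounds(2) bdd) auto
  qed simp
qed

text \<open>In each product the weights of \<open>Gamma0\<close> and \<open>Gamma1\<close> leave the
  unweighted derivative term. The remaining terms of \<open>Gamma1\<close> are a real symmetric
  matrix applied to the boundary values, so they cancel in the difference.\<close>

lemma edge_Green_identity:
  assumes l: "0 < len e" and f: "W22 (len e) (f e) f' (\<lambda>x. - h e x)" and g: "W22 (len e) (g e) g' (\<lambda>x. - k e x)"
  shows "(LINT x:{0..len e}|lborel. h e x * cnj (g e x)) - (LINT x:{0..len e}|lborel. f e x * cnj (k e x)) =
    (fst (Gamma1 len f e) * cnj (fst (Gamma0 len g e)) + snd (Gamma1 len f e) * cnj (snd (Gamma0 len g e))) -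
    (fst (Gamma0 len f e) * cnj (fst (Gamma1 len g e)) + snd (Gamma0 len f e) * cnj (snd (Gamma1 len g e)))"
proof -
  define l where "l = len e"
  \<comment> \<open>With \<open>R\<close> the square root of the length and \<open>R * R\<close> the
    length, the identity becomes one of rational functions.\<close>
  define R where "R = complex_of_real (sqrt l)"
  have l': "0 < l" using l by (simp add: l_def)
  have R: "R \<noteq> 0" "of_real l = R * R" "cnj R = R"
    using l' by (auto simp: R_def simp flip: of_real_mult)
  have "(LINT x:{0..l}|lborel. - h e x * cnj (g e x)) - (LINT x:{0..l}|lborel. f e x * cnj (- k e x))
    = f' l * cnj (g e l) - f' 0 * cnj (g e 0) - f e l * cnj (g' l) + f e 0 * cnj (g' 0)"
    using W22_Green[OF less_imp_le[OF l] f W22_cnj[OF g]] by (simp only: l_def)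
  moreover have "(LINT x:{0..l}|lborel. - h e x * cnj (g e x)) = - (LINT x:{0..l}|lborel. h e x * cnj (g e x))"
    "(LINT x:{0..l}|lborel. f e x * cnj (- k e x)) = - (LINT x:{0..l}|lborel. f e x * cnj (k e x))"
    unfolding set_lebesgue_integral_def by simp_all
  ultimately have "(LINT x:{0..l}|lborel. h e x * cnj (g e x)) - (LINT x:{0..l}|lborel. f e x * cnj (k e x))
    = - f' l * cnj (g e l) + f' 0 * cnj (g e 0) + f e l * cnj (g' l) - f e 0 * cnj (g' 0)"
    by (simp add: algebra_simps)
  also have "\<dots> = (fst (Gamma1 len f e) * cnj (fst (Gamma0 len g e)) + snd (Gamma1 len f e) * cnj (snd (Gamma0 len g e))) -
    (fst (Gamma0 len f e) * cnj (fst (Gamma1 len g e)) + snd (Gamma0 len f e) * cnj (snd (Gamma1 len g e)))"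
    unfolding Gamma1_W22[of len e f, OF l f] Gamma1_W22[of len e g, OF l g] Gamma0_def l_def[symmetric] fst_conv snd_conv
    using R by (simp add: R(2) flip: R_def) (simp add: field_simps)
  finally show ?thesis by (simp only: l_def)
qed

lemma Green_identity:
  assumes pos: "\<forall>e\<in>E. len e > 0" and bdd: "\<And>e. e \<in> E \<Longrightarrow> len e \<le> M"
    and f: "Hmax E len f h" and g: "Hmax E len g k"
  shows "ipG E len h g - ipG E len f k =
    ipBS E (Gamma1 len f) (Gamma0 len g) - ipBS E (Gamma0 len f) (Gamma1 len g)"
proof -
  note G = Gamma_inBS[OF pos bdd f] Gamma_inBS[OF pos bdd g]
  have L: "L2G E len f" "L2G E len h" "L2G E len g" "L2G E len k" using f g by (auto simp: Hmax_def)
  \<comment> \<open>The identity is summed in the form with only plus signs, so that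
    \<open>infsum_add\<close> applies to the four series, each of which converges by itself.\<close>
  have "ipG E len h g + ipBS E (Gamma0 len f) (Gamma1 len g) = (\<Sum>\<^sub>\<infinity>e\<in>E.
      (LINT x:{0..len e}|lborel. h e x * cnj (g e x)) +
      (fst (Gamma0 len f e) * cnj (fst (Gamma1 len g e)) + snd (Gamma0 len f e) * cnj (snd (Gamma1 len g e))))"
    unfolding ipG_def ipBS_def by (rule infsum_add[symmetric, OF ipG_summable[OF L(2,3)] ipBS_summable[OF G(1,4)]])
  also have "\<dots> = (\<Sum>\<^sub>\<infinity>e\<in>E.
      (fst (Gamma1 len f e) * cnj (fst (Gamma0 len g e)) + snd (Gamma1 len f e) * cnj (snd (Gamma0 len g e))) +
      (LINT x:{0..len e}|lborel. f e x * cnj (k e x)))"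
  proof (rule infsum_cong)
    fix e assume e: "e \<in> E"
    obtain f' g' where "W22 (len e) (f e) f' (\<lambda>x. - h e x)" "W22 (len e) (g e) g' (\<lambda>x. - k e x)"
      using HmaxE[OF f e] HmaxE[OF g e] by metis
    from edge_Green_identity[of len e f f' h g g' k, OF _ this] pos e
    show "(LINT x:{0..len e}|lborel. h e x * cnj (g e x)) +
        (fst (Gamma0 len f e) * cnj (fst (Gamma1 len g e)) + snd (Gamma0 len f e) * cnj (snd (Gamma1 len g e))) =
      fst (Gamma1 len f e) * cnj (fst (Gamma0 len g e)) + snd (Gamma1 len f e) * cnj (snd (Gamma0 len g e)) +
        (LINT x:{0..len e}|lborel. f e x * cnj (k e x))"
      by (simp add: algebra_simps)
  qed
  also have "\<dots> = ipBS E (Gamma1 len f) (Gamma0 len g) + ipG E len f k"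
    unfolding ipG_def ipBS_def by (rule infsum_add[OF ipBS_summable[OF G(2,3)] ipG_summable[OF L(1,4)]])
  finally show ?thesis by (simp add: algebra_simps)
qed

section \<open>The maximal operator as adjoint of the minimal one\<close>

lemma Hmin_single_edge:
  assumes pos: "\<forall>e\<in>E. len e > 0" and e0: "e0 \<in> E" and g: "W22 (len e0) g g' g''"
    and b: "g 0 = 0" "g (len e0) = 0" "g' 0 = 0" "g' (len e0) = 0"
  shows "Hmin E len (\<lambda>e. if e = e0 then g else (\<lambda>_. 0)) (\<lambda>e. if e = e0 then (\<lambda>x. - g'' x) else (\<lambda>_. 0))"
proof -
  have Z: "W22 l (\<lambda>_. 0) (\<lambda>_. 0) (\<lambda>_. 0)" for l using W22_affine[of l 0 0] by simp
  have s: "L2G E len (\<lambda>e. if e = e0 then v else (\<lambda>_. 0))" if "sq_int (len e0) v" for v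
  proof -
    \<comment> \<open>All edges other than \<open>e0\<close> carry the zero function, so summability
      over \<open>E\<close> reduces to a singleton.\<close>
    have "(\<lambda>e. nrm2 (len e) (if e = e0 then v else (\<lambda>_. 0))) summable_on E \<longleftrightarrow>
        (\<lambda>e. nrm2 (len e) (if e = e0 then v else (\<lambda>_. 0))) summable_on {e0}"
      using e0 by (intro summable_on_cong_neutral) (auto simp: nrm2_zero)
    then show ?thesis using that W22_sq_int[OF Z] by (auto simp: L2G_iff)
  qed
  have "L2G E len (\<lambda>e. if e = e0 then g else (\<lambda>_. 0))"
    "L2G E len (\<lambda>e. if e = e0 then (\<lambda>x. - g'' x) else (\<lambda>_. 0))"
    by (intro s W22_sq_int[OF g] sq_int_uminus W22_sq_int2[OF g])+
  moreover have "\<exists>u'. W22 (len e) (if e = e0 then g else (\<lambda>_. 0)) u'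
      (\<lambda>x. - (if e = e0 then (\<lambda>x. - g'' x) else (\<lambda>_. 0)) x)" for e
    using g Z by (cases "e = e0") auto
  ultimately have H: "Hmax E len (\<lambda>e. if e = e0 then g else (\<lambda>_. 0)) (\<lambda>e. if e = e0 then (\<lambda>x. - g'' x) else (\<lambda>_. 0))"
    by (simp add: Hmax_def)
  have "dv (len e) (if e = e0 then g else (\<lambda>_. 0)) x = 0" if "e \<in> E" "x \<in> {0, len e}" for e x
    using W22_dv[OF _ g, of x] W22_dv[OF _ Z, of "len e" x] that pos b by (cases "e = e0") auto
  with H b show ?thesis by (auto simp: Hmin_def)
qed

lemma ipG_single_edge:
  assumes "e0 \<in> E" "\<And>e x. e \<in> E \<Longrightarrow> e \<noteq> e0 \<Longrightarrow> f e x = 0"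
  shows "ipG E len f g = (LINT x:{0..len e0}|lborel. f e0 x * cnj (g e0 x))"
proof -
  have "ipG E len f g = (\<Sum>\<^sub>\<infinity>e\<in>{e0}. LINT x:{0..len e}|lborel. f e x * cnj (g e x))"
    unfolding ipG_def using assms by (intro infsum_cong_neutral) auto
  then show ?thesis by simp
qed

text \<open>The left side says that (f, h) lies in the graph of the adjoint. Test functions
  supported on one edge reduce it to the weak formulation there; the representatives so chosen agree
  with \<open>f\<close> almost everywhere and inherit square summability. Conversely, both boundary
  maps vanish on the domain of \<open>Hmin\<close>, so Green's identity has no boundary
  term.\<close>

lemma adjoint_Hmin:
  assumes pos: "\<forall>e\<in>E. len e > 0" and bdd: "\<And>e. e \<in> E \<Longrightarrow> len e \<le> M"
    and f: "L2G E len f" and h: "L2G E len h"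
  shows "(\<forall>g k. Hmin E len g k \<longrightarrow> ipG E len k f = ipG E len g h) \<longleftrightarrow>
    (\<exists>f'. Hmax E len f' h \<and> aeq E len f' f)"
proof
  assume weak: "\<forall>g k. Hmin E len g k \<longrightarrow> ipG E len k f = ipG E len g h"
  have "\<forall>e\<in>E. \<exists>F. (\<exists>F'. W22 (len e) F F' (\<lambda>x. - h e x)) \<and> (AE x in lborel. x \<in> {0..len e} \<longrightarrow> F x = f e x)"
  proof
    fix e assume e: "e \<in> E"
    have l: "0 < len e" and fe: "sq_int (len e) (f e)" and he: "sq_int (len e) (h e)"
      using pos f h e by (auto simp: L2G_def)
    obtain F F' where "W22 (len e) F F' (\<lambda>x. - h e x)" "AE x in lborel. x \<in> {0..len e} \<longrightarrow> F x = f e x"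
    proof (rule W22_weak_formulation[OF l fe he])
      fix g g' g'' assume g: "W22 (len e) g g' g''" "g 0 = 0" "g (len e) = 0" "g' 0 = 0" "g' (len e) = 0"
      note weak[rule_format, OF Hmin_single_edge[OF pos e g]]
      then have "(LINT x:{0..len e}|lborel. - g'' x * cnj (f e x)) = (LINT x:{0..len e}|lborel. g x * cnj (h e x))"
        by (simp add: ipG_single_edge[OF e])
      moreover have "(LINT x:{0..len e}|lborel. - g'' x * cnj (f e x)) = - (LINT x:{0..len e}|lborel. g'' x * cnj (f e x))"
        unfolding set_lebesgue_integral_def by simp
      ultimately show "- (LINT x:{0..len e}|lborel. g'' x * cnj (f e x)) = (LINT x:{0..len e}|lborel. g x * cnj (h e x))"
        by simp
    qed blast
    then show "\<exists>F. (\<exists>F'. W22 (len e) F F' (\<lambda>x. - h e x)) \<and> (AE x in lborel. x \<in> {0..len e} \<longrightarrow> F x = f e x)"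
      by blast
  qed
  then obtain F where F: "\<And>e. e \<in> E \<Longrightarrow> \<exists>F'. W22 (len e) (F e) F' (\<lambda>x. - h e x)"
    "\<And>e. e \<in> E \<Longrightarrow> AE x in lborel. x \<in> {0..len e} \<longrightarrow> F e x = f e x"
    by metis
  have sF: "sq_int (len e) (F e)" if "e \<in> E" for e using F(1)[OF that] W22_sq_int by blast
  have "nrm2 (len e) (F e) = nrm2 (len e) (f e)" if "e \<in> E" for e
    using that f by (intro nrm2_cong_AE sF F(2)) (auto simp: L2G_def)
  then have "L2G E len F" using f sF by (simp add: L2G_iff cong: summable_on_cong)
  then show "\<exists>f'. Hmax E len f' h \<and> aeq E len f' f"
    using F h by (intro exI[of _ F]) (auto simp: Hmax_def aeq_def)
next
  assume "\<exists>f'. Hmax E len f' h \<and> aeq E len f' f"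
  then obtain F where F: "Hmax E len F h" "aeq E len F f" by blast
  show "\<forall>g k. Hmin E len g k \<longrightarrow> ipG E len k f = ipG E len g h"
  proof (intro allI impI)
    fix g k assume g: "Hmin E len g k"
    then have gm: "Hmax E len g k" by (simp add: Hmin_def)
    have "ipG E len k f = ipG E len k F"
      unfolding ipG_def
    proof (rule infsum_cong)
      fix e assume e: "e \<in> E"
      have "(LINT x:{0..len e}|lborel. k e x * cnj (F e x)) = (LINT x:{0..len e}|lborel. k e x * cnj (f e x))"
        using e F f gm by (intro integral_mult_cong_AE) (auto simp: Hmax_def L2G_def aeq_def)
      then show "(LINT x:{0..len e}|lborel. k e x * cnj (f e x)) = (LINT x:{0..len e}|lborel. k e x * cnj (F e x))" ..
    qed
    moreover have "Gamma0 len g e = (0, 0)" "Gamma1 len g e = (0, 0)" if "e \<in> E" for e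
      using g that by (simp_all add: Hmin_def Gamma0_def Gamma1_def Let_def)
    then have "ipBS E (Gamma1 len g) (Gamma0 len F) = 0" "ipBS E (Gamma0 len g) (Gamma1 len F) = 0"
      unfolding ipBS_def by (auto intro!: infsum_0)
    ultimately show "ipG E len k f = ipG E len g h"
      using Green_identity[OF pos bdd gm F(1)] by simp
  qed
qed

section \<open>Joint surjectivity of the boundary maps\<close>

lemma sum_power2_le: "(a + b)\<^sup>2 \<le> 2 * (a\<^sup>2 + b\<^sup>2)" for a b :: real
  using sum_squares_bound[of a b] by (simp add: power2_sum)

text \<open>Interpolation edge by edge, with the weights undone in the data. The norms that result
  are at most A + l^2 B for the function and 4 B for its second derivative, with A and B the sums of
  the moduli of the components of \<open>\<phi> e\<close> and \<open>\<psi> e\<close>. So the edge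
  functions are square summable when the lengths are bounded.\<close>

lemma Gamma_surjective:
  assumes pos: "\<forall>e\<in>E. len e > 0" and bdd: "\<And>e. e \<in> E \<Longrightarrow> len e \<le> M"
    and \<phi>: "inBS E \<phi>" and \<psi>: "inBS E \<psi>"
  shows "\<exists>f h. Hmax E len f h \<and> (\<forall>e\<in>E. Gamma0 len f e = \<phi> e \<and> Gamma1 len f e = \<psi> e)"
proof -
  define n where "n = (\<lambda>\<phi> (e::'a). (cmod (fst (\<phi> e)))\<^sup>2 + (cmod (snd (\<phi> e)))\<^sup>2)"
  have n: "(cmod (fst (\<phi> e)) + cmod (snd (\<phi> e)))\<^sup>2 \<le> 2 * n \<phi> e" for \<phi> e
    unfolding n_def by (rule sum_power2_le)
  \<comment> \<open>All requirements on one edge are packed together so that a choice over the edges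
    delivers them at once. The third function plays the role of \<open>h\<close>, hence it is minus
    the second derivative.\<close>
  define P where "P = (\<lambda>e u u' u''. W22 (len e) u u' (\<lambda>x. - u'' x) \<and>
      nrm2 (len e) u \<le> 4 * n \<phi> e + 4 * M ^ 4 * n \<psi> e \<and> nrm2 (len e) u'' \<le> 32 * n \<psi> e \<and>
      of_real (sqrt (len e)) * u 0 = fst (\<phi> e) \<and> of_real (sqrt (len e)) * u (len e) = snd (\<phi> e) \<and>
      of_real (1 / (len e * sqrt (len e))) * (of_real (len e) * u' 0 + u 0 - u (len e)) = fst (\<psi> e) \<and>
      of_real (1 / (len e * sqrt (len e))) * (of_real (len e) * - u' (len e) - u 0 + u (len e)) = snd (\<psi> e))"
  have "\<exists>u u' u''. P e u u' u''"
    if e: "e \<in> E" for e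
  proof -
    define l where "l = len e"
    have l: "0 < l" "l \<le> M" using pos bdd e by (auto simp: l_def)
    define r where "r = sqrt l"
    have r: "0 < r" "r * r = l" using l by (auto simp: r_def)
    define A B where "A = cmod (fst (\<phi> e)) + cmod (snd (\<phi> e))" and "B = cmod (fst (\<psi> e)) + cmod (snd (\<psi> e))"
    obtain u u' u'' where u: "W22 l u u' u''" "u 0 = fst (\<phi> e) / of_real r" "u l = snd (\<phi> e) / of_real r"
      "of_real l * u' 0 + fst (\<phi> e) / of_real r - snd (\<phi> e) / of_real r = of_real (l * r) * fst (\<psi> e)"
      "of_real l * - u' l - fst (\<phi> e) / of_real r + snd (\<phi> e) / of_real r = of_real (l * r) * snd (\<psi> e)"
      "nrm2 l u \<le> l * (cmod (fst (\<phi> e) / of_real r) + cmod (snd (\<phi> e) / of_real r) +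
         cmod (of_real (l * r) * fst (\<psi> e)) + cmod (of_real (l * r) * snd (\<psi> e)))\<^sup>2"
      "nrm2 l u'' \<le> 16 / l ^ 3 * (cmod (of_real (l * r) * fst (\<psi> e)) + cmod (of_real (l * r) * snd (\<psi> e)))\<^sup>2"
      by (rule W22_hermite_interpolation[OF l(1)])
    have c: "cmod (x / of_real r) = cmod x / r" "cmod (of_real (l * r) * x) = l * r * cmod x" for x
      using l r by (simp_all add: norm_divide norm_mult)
    have "l * (cmod (fst (\<phi> e) / of_real r) + cmod (snd (\<phi> e) / of_real r) +
         cmod (of_real (l * r) * fst (\<psi> e)) + cmod (of_real (l * r) * snd (\<psi> e)))\<^sup>2 = l * (A / r + l * r * B)\<^sup>2"
      unfolding c A_def B_def by (simp add: add_divide_distrib distrib_left add.assoc)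
    \<comment> \<open>The outer factor l is r^2; pulled into the square, it cancels the 1/r coming
      from the prescribed boundary values.\<close>
    also have "\<dots> = (r * (A / r + l * r * B))\<^sup>2"
      unfolding power_mult_distrib using r(2) by (simp only: power2_eq_square)
    also have "r * (A / r + l * r * B) = A + l\<^sup>2 * B"
      using r by (simp add: distrib_left power2_eq_square flip: r(2))
    also have "(A + l\<^sup>2 * B)\<^sup>2 \<le> 2 * (A\<^sup>2 + (l\<^sup>2 * B)\<^sup>2)" by (rule sum_power2_le)
    also have "\<dots> = 2 * A\<^sup>2 + 2 * (l ^ 4 * B\<^sup>2)" by (simp add: power_mult_distrib flip: power_mult)
    also have "\<dots> \<le> 2 * (2 * n \<phi> e) + 2 * (M ^ 4 * (2 * n \<psi> e))"
      unfolding A_def B_def using l n by (intro add_mono mult_left_mono mult_mono power_mono) auto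
    finally have 1: "nrm2 l u \<le> 4 * n \<phi> e + 4 * M ^ 4 * n \<psi> e" using u(6) by simp
    have "16 / l ^ 3 * (cmod (of_real (l * r) * fst (\<psi> e)) + cmod (of_real (l * r) * snd (\<psi> e)))\<^sup>2
        = 16 / l ^ 3 * (l * r * B)\<^sup>2"
      unfolding c B_def by (simp add: distrib_left)
    also have "(l * r * B)\<^sup>2 = l * l * (r * r) * B\<^sup>2" by (simp add: power2_eq_square mult_ac)
    also have "16 / l ^ 3 * \<dots> = 16 * B\<^sup>2" unfolding r(2) using l by (simp add: power3_eq_cube)
    finally have 2: "nrm2 l u'' \<le> 32 * n \<psi> e" using u(7) n[of \<psi> e] by (simp add: B_def)
    have "W22 l u u' (\<lambda>x. - (- u'' x))" using u(1) by simp
    moreover have "nrm2 l (\<lambda>x. - u'' x) \<le> 32 * n \<psi> e" using 2 by (simp add: nrm2_uminus)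
    moreover have "of_real (1 / (l * r)) * (of_real (l * r) * x) = x" for x :: complex
      using l r by simp
    ultimately show ?thesis
      unfolding P_def l_def[symmetric] r_def[symmetric] using 1 u(2-5) r
      by (intro exI[of _ u] exI[of _ u'] exI[of _ "\<lambda>x. - u'' x"]) (simp del: of_real_mult of_real_divide)
  qed
  then obtain f f' h where P: "\<And>e. e \<in> E \<Longrightarrow> P e (f e) (f' e) (h e)" by metis
  have fh: "\<And>e. e \<in> E \<Longrightarrow> W22 (len e) (f e) (f' e) (\<lambda>x. - h e x)"
      "\<And>e. e \<in> E \<Longrightarrow> nrm2 (len e) (f e) \<le> 4 * n \<phi> e + 4 * M ^ 4 * n \<psi> e"
      "\<And>e. e \<in> E \<Longrightarrow> nrm2 (len e) (h e) \<le> 32 * n \<psi> e"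
      "\<And>e. e \<in> E \<Longrightarrow> of_real (sqrt (len e)) * f e 0 = fst (\<phi> e)"
      "\<And>e. e \<in> E \<Longrightarrow> of_real (sqrt (len e)) * f e (len e) = snd (\<phi> e)"
      "\<And>e. e \<in> E \<Longrightarrow> of_real (1 / (len e * sqrt (len e))) * (of_real (len e) * f' e 0 + f e 0 - f e (len e)) = fst (\<psi> e)"
      "\<And>e. e \<in> E \<Longrightarrow> of_real (1 / (len e * sqrt (len e))) * (of_real (len e) * - f' e (len e) - f e 0 + f e (len e)) = snd (\<psi> e)"
    using P unfolding P_def by blast+
  have s: "n \<phi> summable_on E" "n \<psi> summable_on E" using \<phi> \<psi> by (auto simp: inBS_def n_def)
  have "sq_int (len e) (h e)" if "e \<in> E" for e
    using sq_int_uminus[OF W22_sq_int2[OF fh(1)[OF that]]] by simp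
  moreover have "(\<lambda>e. nrm2 (len e) (f e)) summable_on E"
    by (rule summable_on_comparison_test[OF _ fh(2) nrm2_nonneg]) (intro summable_on_add summable_on_cmult_right s)+
  moreover have "(\<lambda>e. nrm2 (len e) (h e)) summable_on E"
    by (rule summable_on_comparison_test[OF _ fh(3) nrm2_nonneg]) (intro summable_on_cmult_right s)+
  ultimately have "Hmax E len f h"
    using fh(1) W22_sq_int by (fastforce simp: Hmax_def L2G_iff)
  moreover have "Gamma0 len f e = \<phi> e \<and> Gamma1 len f e = \<psi> e" if "e \<in> E" for e
    using fh(4-7)[OF that] Gamma1_W22[of len e f, OF _ fh(1)[OF that]] pos that by (simp add: Gamma0_def)
  ultimately show ?thesis by blast
qed

section \<open>The Weyl function\<close>

lemma Weyl_solution_exists: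
  assumes pos: "\<forall>e\<in>E. len e > 0" and z: "Im z \<noteq> 0" and \<phi>: "inBS E \<phi>"
  shows "\<exists>f. Hmax E len f (\<lambda>e x. z * f e x) \<and> (\<forall>e\<in>E. Gamma0 len f e = \<phi> e)"
proof -
  define n where "n = (\<lambda>e. (cmod (fst (\<phi> e)))\<^sup>2 + (cmod (snd (\<phi> e)))\<^sup>2)"
  \<comment> \<open>This constant depends on \<open>z\<close> alone. The factor \<open>len e\<close>
    in the norm bound cancels the square of the 1/\<open>r\<close> in the boundary data, so the edge
    bounds are summable.\<close>
  define K where "K = (Re (csqrt z) / Im (csqrt z))\<^sup>2 + 1"
  have "\<exists>u u'. W22 (len e) u u' (\<lambda>x. - (z * u x)) \<and> nrm2 (len e) u \<le> K * 2 * n e \<and>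
      of_real (sqrt (len e)) * u 0 = fst (\<phi> e) \<and> of_real (sqrt (len e)) * u (len e) = snd (\<phi> e)"
    if e: "e \<in> E" for e
  proof -
    define r where "r = sqrt (len e)"
    have l: "0 < len e" and r: "0 < r" "r * r = len e" using pos e by (auto simp: r_def)
    obtain u u' where u: "W22 (len e) u u' (\<lambda>x. - (z * u x))" "u 0 = fst (\<phi> e) / of_real r"
      "u (len e) = snd (\<phi> e) / of_real r"
      "nrm2 (len e) u \<le> len e * (K * (cmod (fst (\<phi> e) / of_real r) + cmod (snd (\<phi> e) / of_real r))\<^sup>2)"
      unfolding K_def by (rule eigenfunction_exists[OF l z])
    have "cmod (fst (\<phi> e) / of_real r) + cmod (snd (\<phi> e) / of_real r) = (cmod (fst (\<phi> e)) + cmod (snd (\<phi> e))) / r"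
      using r by (simp add: norm_divide add_divide_distrib)
    then have "len e * (K * (cmod (fst (\<phi> e) / of_real r) + cmod (snd (\<phi> e) / of_real r))\<^sup>2)
        = K * (cmod (fst (\<phi> e)) + cmod (snd (\<phi> e)))\<^sup>2"
      using r by (simp add: power_divide power2_eq_square flip: r(2))
    also have "\<dots> \<le> K * (2 * n e)"
      unfolding n_def by (intro mult_left_mono sum_power2_le) (simp add: K_def)
    finally have "nrm2 (len e) u \<le> K * 2 * n e" using u(4) by simp
    then show ?thesis
      using u(1-3) r by (intro exI[of _ u] exI[of _ u']) (simp flip: r_def)
  qed
  then obtain f f' where f: "\<And>e. e \<in> E \<Longrightarrow> W22 (len e) (f e) (f' e) (\<lambda>x. - (z * f e x))"
      "\<And>e. e \<in> E \<Longrightarrow> nrm2 (len e) (f e) \<le> K * 2 * n e"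
      "\<And>e. e \<in> E \<Longrightarrow> of_real (sqrt (len e)) * f e 0 = fst (\<phi> e)"
      "\<And>e. e \<in> E \<Longrightarrow> of_real (sqrt (len e)) * f e (len e) = snd (\<phi> e)"
    by metis
  have "n summable_on E" using \<phi> by (simp add: inBS_def n_def)
  then have "(\<lambda>e. K * 2 * n e) summable_on E" by (rule summable_on_cmult_right)
  then have s: "(\<lambda>e. nrm2 (len e) (f e)) summable_on E"
    by (rule summable_on_comparison_test[OF _ f(2) nrm2_nonneg])
  have sq: "sq_int (len e) (f e)" if "e \<in> E" for e using W22_sq_int[OF f(1)[OF that]] .
  have "Hmax E len f (\<lambda>e x. z * f e x)"
    unfolding Hmax_def L2G_iff nrm2_cmult using s sq f(1)
    by (auto intro!: summable_on_cmult_right sq_int_cmult)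
  with f show ?thesis by (intro exI[of _ f]) (auto simp: Gamma0_def)
qed

lemma Weyl_solution_unique:
  assumes pos: "\<forall>e\<in>E. len e > 0" and z: "Im z \<noteq> 0"
    and f1: "Hmax E len f1 (\<lambda>e x. z * f1 e x)" and f2: "Hmax E len f2 (\<lambda>e x. z * f2 e x)"
    and eq: "\<forall>e\<in>E. Gamma0 len f1 e = Gamma0 len f2 e"
  shows "aeq E len f1 f2"
  unfolding aeq_def
proof
  fix e assume e: "e \<in> E"
  have l: "0 < len e" using pos e by simp
  obtain u1 u2 where u: "W22 (len e) (f1 e) u1 (\<lambda>x. - (z * f1 e x))" "W22 (len e) (f2 e) u2 (\<lambda>x. - (z * f2 e x))"
    using HmaxE[OF f1 e] HmaxE[OF f2 e] by metis
  have "W22 (len e) (\<lambda>x. f1 e x - f2 e x) (\<lambda>x. u1 x - u2 x) (\<lambda>x. - (z * (f1 e x - f2 e x)))"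
    using W22_diff[OF u] by (simp add: algebra_simps)
  moreover have "f1 e 0 = f2 e 0" "f1 e (len e) = f2 e (len e)"
    using eq e l by (auto simp: Gamma0_def)
  ultimately have "AE x in lborel. x \<in> {0..len e} \<longrightarrow> f1 e x - f2 e x = 0"
    by (intro eigenfunction_unique[OF l z]) auto
  then show "AE x in lborel. x \<in> {0..len e} \<longrightarrow> f1 e x = f2 e x" by simp
qed

text \<open>Dividing the derivative formulas by sin(l sqrt z) expresses the inward derivatives
  through the boundary values, with cotangent and cosecant as coefficients. The matrix without
  trigonometric functions in \<open>Me\<close> comes from the difference terms in
  \<open>Gamma1\<close>.\<close>

lemma Weyl_function_edge:
  assumes l: "0 < len e" and z: "Im z \<noteq> 0" and u: "W22 (len e) (f e) u' (\<lambda>x. - (z * f e x))"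
  shows "Gamma1 len f e = Me (len e) z (Gamma0 len f e)"
proof -
  define s where "s = csqrt z"
  define R where "R = complex_of_real (sqrt (len e))"
  define S where "S = sin (of_real (len e) * s)"
  define C where "C = cos (of_real (len e) * s)"
  have R: "R \<noteq> 0" "complex_of_real (len e) = R * R" using l by (auto simp: R_def simp flip: of_real_mult)
  have S: "S \<noteq> 0" unfolding S_def s_def by (intro sin_nonzero_nonreal Im_csqrt_nonzero z l)
  note D = eigenfunction_derivatives[OF l u, folded s_def, folded S_def C_def]
  have d0: "u' 0 = (s * f e (len e) - s * C * f e 0) / S" using D(1) S by (simp add: field_simps)
  have dl: "- u' (len e) = (s * f e 0 - s * C * f e (len e)) / S" using D(2) S by (simp add: field_simps)
  have c: "complex_of_real (1 / (len e * sqrt (len e))) = 1 / (R * R * R)" "complex_of_real (1 / len e) = 1 / (R * R)"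
    using R by (simp_all flip: R_def)
  show ?thesis
    unfolding Gamma1_W22[of len e f, OF l u] Me_def Let_def Gamma0_def fst_conv snd_conv
      s_def[symmetric] S_def[symmetric] C_def[symmetric] R_def[symmetric] c d0 dl prod.inject
    unfolding R(2)
    using R(1) S by (intro conjI) (simp_all add: divide_simps, simp_all add: algebra_simps)
qed

lemma Weyl_function:
  assumes "\<forall>e\<in>E. len e > 0" and "Im z \<noteq> 0" and f: "Hmax E len f (\<lambda>e x. z * f e x)" and e: "e \<in> E"
  shows "Gamma1 len f e = Me (len e) z (Gamma0 len f e)"
proof (rule HmaxE[OF f e])
  fix u' assume "W22 (len e) (f e) u' (\<lambda>x. - (z * f e x))"
  with assms show ?thesis by (intro Weyl_function_edge[of len e z f]) auto
qed

theorem mainTheorem1: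
  fixes E :: "'e set" and len :: "'e \<Rightarrow> real"
  assumes "countable E"
    and "\<forall>e\<in>E. len e > 0"
    and "bdd_above (len ` E)"
  shows
    \<comment> \<open>H_max is the adjoint of H_min\<close>
    "(\<forall>f h. L2G E len f \<and> L2G E len h \<longrightarrow>
        ((\<forall>g k. Hmin E len g k \<longrightarrow> ipG E len k f = ipG E len g h) \<longleftrightarrow>
         (\<exists>f'. Hmax E len f' h \<and> aeq E len f' f)))
   \<and> \<comment> \<open>Gamma0, Gamma1 map dom(H_max) into the boundary space\<close>
     (\<forall>f h. Hmax E len f h \<longrightarrow> inBS E (Gamma0 len f) \<and> inBS E (Gamma1 len f))
   \<and> \<comment> \<open>abstract Green identity\<close>
     (\<forall>f h g k. Hmax E len f h \<longrightarrow> Hmax E len g k \<longrightarrow>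
        ipG E len h g - ipG E len f k =
        ipBS E (Gamma1 len f) (Gamma0 len g) - ipBS E (Gamma0 len f) (Gamma1 len g))
   \<and> \<comment> \<open>surjectivity of (Gamma0, Gamma1)\<close>
     (\<forall>\<phi> \<psi>. inBS E \<phi> \<longrightarrow> inBS E \<psi> \<longrightarrow>
        (\<exists>f h. Hmax E len f h \<and> (\<forall>e\<in>E. Gamma0 len f e = \<phi> e \<and> Gamma1 len f e = \<psi> e)))
   \<and> \<comment> \<open>Weyl function: Gamma0 restricted to N_z is bijective onto the boundary space,
        and M(z) = Gamma1 (Gamma0|N_z)^-1 is the direct sum of the M_e(z)\<close>
     (\<forall>z. Im z \<noteq> 0 \<longrightarrow>
        (\<forall>\<phi>. inBS E \<phi> \<longrightarrow>
           (\<exists>f. Hmax E len f (\<lambda>e x. z * f e x) \<and> (\<forall>e\<in>E. Gamma0 len f e = \<phi> e)))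
      \<and> (\<forall>f1 f2. Hmax E len f1 (\<lambda>e x. z * f1 e x) \<longrightarrow> Hmax E len f2 (\<lambda>e x. z * f2 e x) \<longrightarrow>
           (\<forall>e\<in>E. Gamma0 len f1 e = Gamma0 len f2 e) \<longrightarrow> aeq E len f1 f2)
      \<and> (\<forall>f. Hmax E len f (\<lambda>e x. z * f e x) \<longrightarrow>
           (\<forall>e\<in>E. Gamma1 len f e = Me (len e) z (Gamma0 len f e))))"
proof -
  obtain M where M: "\<And>e. e \<in> E \<Longrightarrow> len e \<le> M" using assms(3) by (auto simp: bdd_above_def)
  note pos = assms(2)
  show ?thesis
    by (intro conjI allI impI ballI; (elim conjE)?)
      (rule adjoint_Hmin[OF pos M] Gamma_inBS[OF pos M] Green_identity[OF pos M]
        Gamma_surjective[OF pos M] Weyl_solution_exists[OF pos] Weyl_solution_unique[OF pos]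
        Weyl_function[OF pos]; assumption)+
qed

end
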